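(* Let $(\mathcal{X}_1,\mathcal{X}_2,p(y_2|x_1)p(y_3|x_1,x_2,y_2),\mathcal{Y}_2,\mathcal{Y}_3)$ be a discrete memoryless noncausal relay channel with capacity $C_\infty$. Then \[ C_{\infty} \geq \max \min\{I(X_1;Y_2),\; I(X_1,U;Y_3)-I(U;Y_2|X_1)\}, \] where the maximum is over all pmfs $p(x_1)p(u|x_1,y_2)$ (with $U$ taking values in a finite set) and all functions $x_2(u,x_1,y_2)$, and the mutual informations are evaluated under the joint distribution $p(x_1)p(y_2|x_1)p(u|x_1,y_2)\mathbf{1}\{x_2=x_2(u,x_1,y_2)\}p(y_3|x_1,x_2,y_2)$.
   Context: A discrete memoryless (DM) noncausal relay channel consists of finite alphabets $\mathcal{X}_1,\mathcal{X}_2,\mathcal{Y}_2,\mathcal{Y}_3$ and conditional pmfs $p(y_2|x_1)$ and $p(y_3|x_1,x_2,y_2)$; the sender inputs $X_1$, the relay observes $Y_2$ and inputs $X_2$, the receiver observes $Y_3$. It is memoryless: $p(y_{2i}|x_1^i,y_2^{i-1},m)=p(y_{2i}|x_{1i})$ and $p(y_{3i}|x_1^i,x_2^i,y_2^i,y_3^{i-1},m)=p(y_{3i}|x_{1i},x_{2i},y_{2i})$. A $(2^{nR},n)$ code consists of a message set $[1:2^{nR}]$, an encoder assigning a codeword $x_1^n(m)$ to each message $m$, a relay encoder assigning a symbol $x_{2i}(y_2^n)$ for each $i\in[1:n]$ as a function of the entire received sequence $y_2^n$ (noncausal, i.e., unlimited lookahead), and a decoder assigning an estimate $\hat m(y_3^n)$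 or an error. The message $M$ is uniform over $[1:2^{nR}]$, the error probability is $P_e^{(n)}=\mathbb{P}\{\hat M\neq M\}$, a rate $R$ is achievable if there is a sequence of $(2^{nR},n)$ codes with $P_e^{(n)}\to 0$, and the capacity $C_\infty$ is the supremum of achievable rates. *)

theory Defs
  imports "HOL-Probability.Probability"
begin

definition mutual_info :: "('a \<times> 'b) pmf \<Rightarrow> real" where
  "mutual_info J =
     (\<Sum>(a, b) \<in> set_pmf J. pmf J (a, b) *
        log 2 (pmf J (a, b) / (pmf (map_pmf fst J) a * pmf (map_pmf snd J) b)))"

definition cond_mutual_info :: "('a \<times> 'b \<times> 'c) pmf \<Rightarrow> real" where
  "cond_mutual_info J =
     (\<Sum>(a, b, c) \<in> set_pmf J. pmf J (a, b, c) *
        log 2 (pmf J (a, b, c) * pmf (map_pmf (\<lambda>(a, b, c). c) J) c /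
               (pmf (map_pmf (\<lambda>(a, b, c). (a, c)) J) (a, c) *
                pmf (map_pmf (\<lambda>(a, b, c). (b, c)) J) (b, c))))"

text \<open>The channel is given by kernels W2 = p(y2|x1) and W3 = p(y3|x1,x2,y2).
  A code of block length n with M messages (set {1..M}) consists of
  an encoder enc m i (the i-th symbol of x1^n(m), i < n),
  a noncausal relay rel i y2s (the i-th relay symbol as a function of the whole
  sequence y2^n, given as a list of length n), and a decoder dec y3s
  (None = error).  Memorylessness: the channel acts as a product over time.\<close>

definition error_prob ::
  "('x1 \<Rightarrow> 'y2 pmf) \<Rightarrow> ('x1 \<Rightarrow> 'x2 \<Rightarrow> 'y2 \<Rightarrow> 'y3 pmf) \<Rightarrow> nat \<Rightarrow> nat \<Rightarrow>
   (nat \<Rightarrow> nat \<Rightarrow> 'x1) \<Rightarrow> (nat \<Rightarrow> 'y2 list \<Rightarrow> 'x2) \<Rightarrow> ('y3 list \<Rightarrow> nat option) \<Rightarrow> real" where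
  "error_prob W2 W3 n M enc rel dec =
     (1 / real M) * (\<Sum>m \<in> {1..M}.
        \<Sum>y2s \<in> {ys. length ys = n}. \<Sum>y3s \<in> {ys. length ys = n}.
          (\<Prod>i<n. pmf (W2 (enc m i)) (y2s ! i)) *
          (\<Prod>i<n. pmf (W3 (enc m i) (rel i y2s) (y2s ! i)) (y3s ! i)) *
          (if dec y3s = Some m then 0 else 1))"

definition num_msgs :: "nat \<Rightarrow> real \<Rightarrow> nat" where
  "num_msgs n R = nat \<lceil>2 powr (real n * R)\<rceil>"

definition achievable ::
  "('x1 \<Rightarrow> 'y2 pmf) \<Rightarrow> ('x1 \<Rightarrow> 'x2 \<Rightarrow> 'y2 \<Rightarrow> 'y3 pmf) \<Rightarrow> real \<Rightarrow> bool" where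
  "achievable W2 W3 R \<longleftrightarrow> 0 \<le> R \<and>
     (\<exists>enc rel dec.
        (\<lambda>n. error_prob W2 W3 n (num_msgs n R) (enc n) (rel n) (dec n)) \<longlonglongrightarrow> 0)"

definition capacity_noncausal ::
  "('x1 \<Rightarrow> 'y2 pmf) \<Rightarrow> ('x1 \<Rightarrow> 'x2 \<Rightarrow> 'y2 \<Rightarrow> 'y3 pmf) \<Rightarrow> ereal" where
  "capacity_noncausal W2 W3 = Sup (ereal ` {R. achievable W2 W3 R})"

definition relay_joint ::
  "('x1 \<Rightarrow> 'y2 pmf) \<Rightarrow> ('x1 \<Rightarrow> 'x2 \<Rightarrow> 'y2 \<Rightarrow> 'y3 pmf) \<Rightarrow> 'x1 pmf \<Rightarrow>
   ('x1 \<Rightarrow> 'y2 \<Rightarrow> 'u pmf) \<Rightarrow> ('u \<Rightarrow> 'x1 \<Rightarrow> 'y2 \<Rightarrow> 'x2) \<Rightarrow>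
   ('x1 \<times> 'u \<times> 'y2 \<times> 'x2 \<times> 'y3) pmf" where
  "relay_joint W2 W3 P Q f =
     bind_pmf P (\<lambda>x1. bind_pmf (W2 x1) (\<lambda>y2. bind_pmf (Q x1 y2) (\<lambda>u.
       map_pmf (\<lambda>y3. (x1, u, y2, f u x1 y2, y3)) (W3 x1 (f u x1 y2) y2))))"

end

theory Submission
  imports Defs "HOL-Real_Asymp.Real_Asymp"
begin

text \<open>
  Random coding. Each message \<open>m\<close> gets a codeword \<open>x\<^sub>1\<close> and, conditionally on it, a list of \<open>L\<close>
  auxiliary words \<open>u(l)\<close> drawn from \<open>p(u|x\<^sub>1)\<close>. The noncausal relay sees all of \<open>y\<^sub>2\<close>, decodes \<open>m\<close>
  from it (possible when \<open>R < I(X\<^sub>1;Y\<^sub>2)\<close>), then looks for an \<open>l\<close> such that \<open>u(l)\<close> is jointly typical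
  with \<open>x\<^sub>1\<close> and \<open>y\<^sub>2\<close> (found when \<open>L\<close> exceeds \<open>2 ^ (n I(U;Y\<^sub>2|X\<^sub>1))\<close>), and transmits
  \<open>x\<^sub>2(u(l), x\<^sub>1, y\<^sub>2)\<close>. The receiver tests all pairs \<open>(m, l)\<close>, which succeeds when \<open>2 ^ (n R) L\<close> is below
  \<open>2 ^ (n I(X\<^sub>1,U;Y\<^sub>3))\<close>.

  Typicality is replaced by threshold tests on information densities, so the whole error analysis is
  a one-shot bound for arbitrary distributions; block codes are its instance for product
  distributions, and Hoeffding's inequality makes the remaining error terms vanish.
\<close>

section \<open>Probabilities under composed and product distributions\<close>

lemma integrable_prob_pmf [simp, intro]:
  "integrable (measure_pmf p) (\<lambda>x. measure_pmf.prob (K x) (A x))"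
  by (rule measure_pmf.integrable_const_bound[where B = 1]) auto

lemma prob_bind_pmf:
  "measure_pmf.prob (bind_pmf p K) A = measure_pmf.expectation p (\<lambda>x. measure_pmf.prob (K x) A)"
  unfolding measure_pmf_bind
  by (rule measure_pmf.measure_bind[where N = "count_space UNIV"])
      (auto simp: measurable_def space_subprob_algebra prob_space_imp_subprob_space
          measure_pmf.prob_space_axioms)

lemma integrable_expectation_prob_pmf [simp, intro]:
  "integrable (measure_pmf p) (\<lambda>x. measure_pmf.expectation (N x) (\<lambda>y. measure_pmf.prob (K x y) (A x y)))"
proof (rule measure_pmf.integrable_const_bound[where B = 1])
  have "measure_pmf.expectation (N x) (\<lambda>y. measure_pmf.prob (K x y) (A x y)) \<in> {0..1}" for x
    by (auto intro!: measure_pmf.integral_le_const)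
  then show "AE x in measure_pmf p.
      norm (measure_pmf.expectation (N x) (\<lambda>y. measure_pmf.prob (K x y) (A x y))) \<le> 1"
    by (simp add: AE_measure_pmf_iff)
qed auto

lemma expectation_prob_le:
  assumes "\<And>x. x \<in> set_pmf p \<Longrightarrow> measure_pmf.prob (K x) (A x) \<le> b"
  shows "measure_pmf.expectation p (\<lambda>x. measure_pmf.prob (K x) (A x)) \<le> b"
  by (rule measure_pmf.integral_le_const) (auto simp: AE_measure_pmf_iff assms)

text \<open>On the exceptional set \<open>B\<close> of first-stage outcomes the second stage is
  bounded only by 1, elsewhere by \<open>b\<close>.\<close>

lemma prob_bind_pmf_le_add:
  assumes "\<And>x. x \<in> set_pmf p \<Longrightarrow> x \<notin> B \<Longrightarrow> measure_pmf.prob (K x) A \<le> b" and "0 \<le> b"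
  shows "measure_pmf.prob (bind_pmf p K) A \<le> measure_pmf.prob p B + b"
proof -
  have "measure_pmf.prob (bind_pmf p K) A \<le> measure_pmf.expectation p (\<lambda>x. indicator B x + b)"
    unfolding prob_bind_pmf
  proof (rule integral_mono_AE)
    show "integrable (measure_pmf p) (\<lambda>x. indicator B x + b)"
      by (rule measure_pmf.integrable_const_bound[where B = "1 + \<bar>b\<bar>"]) (auto simp: indicator_def)
    have "measure_pmf.prob (K x) A \<le> indicator B x + b" if "x \<in> set_pmf p" for x
      using assms that measure_pmf.prob_le_1[of "K x" A] by (cases "x \<in> B")
          (auto simp del: measure_pmf.prob_le_1)
    then show "AE x in measure_pmf p. measure_pmf.prob (K x) A \<le> indicator B x + b"
      by (simp add: AE_measure_pmf_iff)
  qed auto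
  also have "\<dots> = measure_pmf.prob p B + b"
    by (subst Bochner_Integration.integral_add)
       (auto intro!: measure_pmf.integrable_const_bound[where B = 1] simp: indicator_def)
  finally show ?thesis .
qed

text \<open>Fubini for two independent variables, obtained from the commutation of
  \<open>bind_pmf\<close>. It allows a test on a random codeword and an output to be averaged over
  the codeword first, with the output held fixed.\<close>

lemma expectation_prob_swap:
  "measure_pmf.expectation p (\<lambda>a. measure_pmf.prob q {b. R a b}) =
   measure_pmf.expectation q (\<lambda>b. measure_pmf.prob p {a. R a b})"
proof -
  have "measure_pmf.expectation p (\<lambda>a. measure_pmf.prob q {b. R a b}) =
      measure_pmf.prob (bind_pmf p (\<lambda>a. bind_pmf q (\<lambda>b. return_pmf (a, b)))) {(a, b). R a b}"
    by (simp add: prob_bind_pmf[of p] map_pmf_def[symmetric] vimage_def)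
  also have "\<dots> = measure_pmf.prob (bind_pmf q (\<lambda>b. bind_pmf p (\<lambda>a. return_pmf (a, b)))) {(a, b). R a b}"
    by (subst bind_commute_pmf) simp
  also have "\<dots> = measure_pmf.expectation q (\<lambda>b. measure_pmf.prob p {a. R a b})"
    by (simp add: prob_bind_pmf[of q] map_pmf_def[symmetric] vimage_def)
  finally show ?thesis .
qed

text \<open>This is the derandomization step: some codebook is no worse than the random
  average.\<close>

lemma exists_le_expectation_pmf:
  fixes f :: "'a \<Rightarrow> real"
  assumes "integrable (measure_pmf p) f" and "measure_pmf.expectation p f \<le> b"
  shows "\<exists>x. f x \<le> b"
proof (rule ccontr)
  assume "\<nexists>x. f x \<le> b"
  then have "b < measure_pmf.expectation p f"
    using assms by (intro measure_pmf.expectation_greater) (auto simp: not_le)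
  then show False using assms by simp
qed

lemma expectation_Pi_pmf_component:
  fixes g :: "'b \<Rightarrow> real"
  assumes "finite I" "i \<in> I"
  shows "measure_pmf.expectation (Pi_pmf I d (\<lambda>_. K)) (\<lambda>c. g (c i)) = measure_pmf.expectation K g"
proof -
  have "measure_pmf.expectation (Pi_pmf I d (\<lambda>_. K)) (\<lambda>c. g (c i)) =
      measure_pmf.expectation (map_pmf (\<lambda>c. c i) (Pi_pmf I d (\<lambda>_. K))) g"
    by simp
  then show ?thesis using assms by (simp only: Pi_pmf_component if_True)
qed

lemma Pi_pmf_two_components:
  assumes "finite I" "i \<in> I" "j \<in> I" "i \<noteq> j"
  shows "map_pmf (\<lambda>c. (c i, c j)) (Pi_pmf I d p) = pair_pmf (p i) (p j)"
proof -
  have I: "I = insert i (I - {i})" using assms by auto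
  have "map_pmf (\<lambda>c. (c i, c j)) (Pi_pmf I d p) =
      map_pmf (\<lambda>(y, f). (y, f j)) (pair_pmf (p i) (Pi_pmf (I - {i}) d p))"
    using assms by (subst I, subst Pi_pmf_insert) (auto simp: map_pmf_comp case_prod_unfold)
  also have "\<dots> = pair_pmf (p i) (map_pmf (\<lambda>f. f j) (Pi_pmf (I - {i}) d p))"
    by (simp add: pair_map_pmf2 apsnd_def map_prod_def)
  also have "map_pmf (\<lambda>f. f j) (Pi_pmf (I - {i}) d p) = p j"
    using assms by (subst Pi_pmf_component) auto
  finally show ?thesis .
qed

text \<open>Codewords of different messages are independent. A bound on the confusion probability
  that is uniform in the transmitted codeword \<open>a\<close> therefore survives averaging over the
  codebook.\<close>

lemma expectation_prob_Pi_pmf_two_components: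
  assumes "finite I" "i \<in> I" "j \<in> I" "i \<noteq> j"
    and "\<And>a. measure_pmf.expectation K (\<lambda>b. measure_pmf.prob (N a) (A b)) \<le> \<beta>"
  shows "measure_pmf.expectation (Pi_pmf I d (\<lambda>_. K)) (\<lambda>c. measure_pmf.prob (N (c i)) (A (c j))) \<le> \<beta>"
proof -
  have "measure_pmf.expectation (Pi_pmf I d (\<lambda>_. K)) (\<lambda>c. measure_pmf.prob (N (c i)) (A (c j))) =
      measure_pmf.expectation (map_pmf (\<lambda>c. (c i, c j)) (Pi_pmf I d (\<lambda>_. K)))
        (\<lambda>(a, b). measure_pmf.prob (N a) (A b))"
    by simp
  also have "\<dots> = measure_pmf.expectation (pair_pmf K K) (\<lambda>(a, b). measure_pmf.prob (N a) (A b))"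
    by (subst Pi_pmf_two_components[OF assms(1-4)]) simp
  \<comment> \<open>The expectation is recast as the probability of one event under a composed
    distribution, so that associativity of \<open>bind_pmf\<close> turns it into an iterated
    expectation.\<close>
  also have "\<dots> = measure_pmf.prob (bind_pmf (pair_pmf K K)
      (\<lambda>(a, b). map_pmf (\<lambda>z. (b, z)) (N a))) {(b, z). z \<in> A b}"
    by (simp add: prob_bind_pmf case_prod_unfold vimage_def)
  also have "bind_pmf (pair_pmf K K) (\<lambda>(a, b). map_pmf (\<lambda>z. (b, z)) (N a)) =
     bind_pmf K (\<lambda>a. bind_pmf K (\<lambda>b. map_pmf (\<lambda>z. (b, z)) (N a)))"
    by (simp add: pair_pmf_def bind_assoc_pmf bind_return_pmf)
  also have "measure_pmf.prob \<dots> {(b, z). z \<in> A b} \<le> \<beta>"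
    unfolding prob_bind_pmf[of K]
    by (rule measure_pmf.integral_le_const)
       (auto simp: AE_measure_pmf_iff prob_bind_pmf vimage_def assms(5))
  finally show ?thesis .
qed

section \<open>Covering inequality, concentration and change of measure\<close>

text \<open>The left side is at most \<open>exp (- a * q * L)\<close>. This is convex in
  \<open>q\<close>, so on [0, 1] it lies below its chord from 1 at \<open>q = 0\<close> to
  \<open>exp (- a * L)\<close> at \<open>q = 1\<close>.\<close>

lemma one_minus_power_le_convex:
  fixes a q r :: real
  assumes "0 \<le> a" "0 \<le> q" "q \<le> 1" "a * q \<le> r" "r \<le> 1"
  shows "(1 - r) ^ L \<le> (1 - q) + exp (- a * real L)"
proof -
  have "(1 - r) ^ L \<le> exp (- r) ^ L"
    using assms exp_ge_add_one_self[of "- r"] by (intro power_mono) auto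
  also have "\<dots> = exp (- r * real L)" by (simp add: exp_of_nat_mult[symmetric] mult.commute)
  also have "\<dots> \<le> exp ((1 - q) *\<^sub>R 0 + q *\<^sub>R (- a * real L))"
    using mult_right_mono[OF assms(4), of "real L"] by (simp add: mult_ac)
  also have "\<dots> \<le> (1 - q) * exp 0 + q * exp (- a * real L)"
    using assms by (intro convex_onD[OF exp_convex]) auto
  also have "\<dots> \<le> (1 - q) + exp (- a * real L)"
    using assms by (simp add: mult_left_le_one_le)
  finally show ?thesis .
qed

text \<open>Hoeffding's inequality for the lower tail. A function on a finite alphabet is bounded,
  so one exponent \<kappa> serves all block lengths.\<close>

lemma prob_Pi_pmf_sum_le:
  fixes p :: "'a::finite pmf" and h :: "'a \<Rightarrow> real"
  assumes "0 < \<epsilon>"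
  shows "\<exists>\<kappa>>0. \<forall>n. measure_pmf.prob (Pi_pmf {..<n} undefined (\<lambda>_. p))
     {g. (\<Sum>i<n. h (g i)) \<le> real n * (measure_pmf.expectation p h - \<epsilon>)} \<le> exp (- \<kappa> * real n)"
proof -
  define B where "B = (\<Sum>x\<in>UNIV. \<bar>h x\<bar>) + 1"
  have B: "\<bar>h x\<bar> \<le> B" for x
    unfolding B_def using member_le_sum[of x UNIV "\<lambda>x. \<bar>h x\<bar>"] by simp
  have B_pos: "0 < B" unfolding B_def by (intro add_nonneg_pos sum_nonneg) auto
  \<comment> \<open>The Hoeffding exponent 2 (n \<epsilon>)^2 / (n (2 B)^2), divided by n. The extra
    1 in \<open>B\<close> keeps the denominator positive when \<open>h\<close> is zero.\<close>
  define \<kappa> where "\<kappa> = 2 * \<epsilon>\<^sup>2 / (2 * B)\<^sup>2"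
  have "measure_pmf.prob (Pi_pmf {..<n} undefined (\<lambda>_. p))
     {g. (\<Sum>i<n. h (g i)) \<le> real n * (measure_pmf.expectation p h - \<epsilon>)} \<le> exp (- \<kappa> * real n)" for n
  proof (cases "n = 0")
    case False
    let ?M = "Pi_pmf {..<n} undefined (\<lambda>_. p)"
    interpret H: Hoeffding_ineq "measure_pmf ?M" "{..<n}" "\<lambda>i g. h (g i)" "\<lambda>_. - B" "\<lambda>_. B"
      "\<Sum>i<n. measure_pmf.expectation ?M (\<lambda>g. h (g i))"
    proof unfold_locales
      show "prob_space.indep_vars (measure_pmf ?M) (\<lambda>_. borel) (\<lambda>i g. h (g i)) {..<n}"
        using prob_space.indep_vars_compose2[OF measure_pmf.prob_space_axioms indep_vars_Pi_pmf[of
            "{..<n}" undefined "\<lambda>_. p"],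
            of "\<lambda>_. h" "\<lambda>_. borel"] by simp
      show "AE x in measure_pmf ?M. h (x i) \<in> {- B..B}" for i
        using B[THEN abs_le_D1] B[THEN abs_le_D2] by (auto simp: minus_le_iff)
    qed auto
    have \<mu>: "(\<Sum>i<n. measure_pmf.expectation ?M (\<lambda>g. h (g i))) = real n * measure_pmf.expectation p h"
      by (simp add: expectation_Pi_pmf_component)
    have "measure_pmf.prob ?M {g. (\<Sum>i<n. h (g i)) \<le> real n * (measure_pmf.expectation p h - \<epsilon>)} \<le>
        exp (- 2 * (real n * \<epsilon>)\<^sup>2 / (\<Sum>i<n. (B - (- B))\<^sup>2))"
      using H.Hoeffding_ineq_le[of "real n * \<epsilon>"] assms False B_pos
      by (simp add: \<mu> right_diff_distrib)
    also have "- 2 * (real n * \<epsilon>)\<^sup>2 / (\<Sum>i<n. (B - (- B))\<^sup>2) = - \<kappa> * real n"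
      using False B_pos by (simp add: \<kappa>_def field_simps power2_eq_square)
    finally show ?thesis .
  qed simp
  moreover have "0 < \<kappa>" using assms B_pos by (simp add: \<kappa>_def)
  ultimately show ?thesis by blast
qed

text \<open>Change of measure by a pointwise likelihood bound. \<open>infsetsum\<close> is used
  because the lemma is later applied to words of type \<open>nat \<Rightarrow> 'u\<close>, which is
  not a finite type.\<close>

lemma prob_le_of_pmf_le:
  assumes "\<And>u. u \<in> A \<Longrightarrow> pmf p u \<le> c * pmf q u"
  shows "measure_pmf.prob p A \<le> c * measure_pmf.prob q A"
proof -
  have "measure_pmf.prob p A = infsetsum (pmf p) A" by (rule measure_pmf_conv_infsetsum)
  also have "\<dots> \<le> infsetsum (\<lambda>u. c * pmf q u) A"
    by (intro infsetsum_mono abs_summable_on_cmult_right pmf_abs_summable assms)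
  also have "\<dots> = c * infsetsum (pmf q) A"
    by (intro infsetsum_cmult_right pmf_abs_summable)
  also have "infsetsum (pmf q) A = measure_pmf.prob q A"
    by (rule measure_pmf_conv_infsetsum[symmetric])
  finally show ?thesis .
qed

text \<open>Markov's inequality, with nonnegativity required only on the support.\<close>

lemma prob_Collect_gt_le:
  fixes \<phi> :: "'a \<Rightarrow> real"
  assumes "0 < \<delta>" "integrable (measure_pmf p) \<phi>" "\<And>x. x \<in> set_pmf p \<Longrightarrow> 0 \<le> \<phi> x"
  shows "measure_pmf.prob p {x. \<delta> < \<phi> x} \<le> measure_pmf.expectation p \<phi> / \<delta>"
proof -
  have "measure_pmf.prob p {x. \<delta> < \<phi> x} = measure_pmf.expectation p (indicator {x. \<delta> < \<phi> x})"
    by simp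
  also have "\<dots> \<le> measure_pmf.expectation p (\<lambda>x. \<phi> x / \<delta>)"
    using assms by (intro integral_mono_AE)
      (auto simp: AE_measure_pmf_iff indicator_def
          intro!: measure_pmf.integrable_const_bound[where B = 1])
  finally show ?thesis by simp
qed

lemma pmf_bind_map_Pair:
  "pmf (bind_pmf p (\<lambda>a. map_pmf (Pair a) (K a))) (a, b) = pmf p a * pmf (K a) b"
proof -
  have "pmf (map_pmf (Pair a') (K a')) (a, b) = indicator {a} a' * pmf (K a) b" for a'
  proof (cases "a' = a")
    case True
    then show ?thesis by (simp add: pmf_map_inj' inj_def)
  next
    case False
    then show ?thesis by (auto simp: pmf_eq_0_set_pmf)
  qed
  then show ?thesis by (simp add: pmf_bind measure_pmf_single)
qed

section \<open>The one-shot random coding bound\<close>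

text \<open>
  \<open>T1\<close> is the relay's decoding test, \<open>G\<close> the relay's criterion for choosing an auxiliary word and \<open>T3\<close>
  the receiver's test. \<open>G\<close> is required to imply that the receiver's test on the chosen pair succeeds
  with conditional probability \<open>1 - \<delta>\<close>; this takes the place of the conditional typicality lemma.
\<close>

locale relay_random_coding =
  fixes P :: "'x pmf" and W2 :: "'x \<Rightarrow> 'y pmf" and V :: "'x \<Rightarrow> 'y \<Rightarrow> 'u pmf" and PU :: "'x \<Rightarrow> 'u pmf"
    and W3 :: "'x \<Rightarrow> 'a \<Rightarrow> 'y \<Rightarrow> 'z pmf" and F :: "'u \<Rightarrow> 'x \<Rightarrow> 'y \<Rightarrow> 'a"
    and T1 :: "'x \<Rightarrow> 'y \<Rightarrow> bool" and G :: "'x \<Rightarrow> 'u \<Rightarrow> 'y \<Rightarrow> bool" and T3 :: "'x \<Rightarrow> 'u \<Rightarrow> 'z \<Rightarrow> bool"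
    and e1 e2 a \<delta> b1 b3 :: real
  assumes T1_typical: "measure_pmf.expectation P (\<lambda>x. measure_pmf.prob (W2 x) {y. \<not> T1 x y}) \<le> e1"
    and T1_packing: "\<And>y. measure_pmf.prob P {x. T1 x y} \<le> b1"
    and G_typical: "measure_pmf.expectation P (\<lambda>x. measure_pmf.expectation (W2 x)
                      (\<lambda>y. measure_pmf.prob (V x y) {u. \<not> G x u y})) \<le> e2"
    and G_covering: "\<And>x y. a * measure_pmf.prob (V x y) {u. G x u y} \<le>
        measure_pmf.prob (PU x) {u. G x u y}"
    and T3_typical: "\<And>x u y. G x u y \<Longrightarrow> measure_pmf.prob (W3 x (F u x y) y) {z. \<not> T3 x u z} \<le> \<delta>"
    and T3_packing: "\<And>z. measure_pmf.expectation P (\<lambda>x. measure_pmf.prob (PU x) {u. T3 x u z}) \<le> b3"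
    and a_nonneg: "0 \<le> a" and \<delta>_nonneg: "0 \<le> \<delta>"
begin

section \<open>The random codebook, the decoders and the union bound\<close>

text \<open>The word \<open>x\<close> and its \<open>L\<close> auxiliary words are bundled into one
  random symbol, so that a codebook is an i.i.d. family indexed by the messages.\<close>

definition codeword :: "nat \<Rightarrow> ('x \<times> (nat \<Rightarrow> 'u)) pmf" where
  "codeword L = bind_pmf P (\<lambda>x. map_pmf (Pair x) (Pi_pmf {..<L} undefined (\<lambda>_. PU x)))"

text \<open>\<open>SOME\<close> is arbitrary here if no index qualifies, and so is \<open>THE\<close> in the two decoders below unless
  exactly one message passes the test; all these events are counted as errors.\<close>

definition relay_symbol :: "nat \<Rightarrow> 'x \<times> (nat \<Rightarrow> 'u) \<Rightarrow> 'y \<Rightarrow> 'a" where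
  "relay_symbol L w y = F (snd w (SOME l. l < L \<and> G (fst w) (snd w l) y)) (fst w) y"

text \<open>The idealized channel whose relay knows the sent message: its output depends on the
  codebook only through \<open>w\<close>.\<close>

definition received :: "nat \<Rightarrow> 'x \<times> (nat \<Rightarrow> 'u) \<Rightarrow> 'z pmf" where
  "received L w = bind_pmf (W2 (fst w)) (\<lambda>y. W3 (fst w) (relay_symbol L w y) y)"

definition accept :: "nat \<Rightarrow> 'x \<times> (nat \<Rightarrow> 'u) \<Rightarrow> 'z \<Rightarrow> bool" where
  "accept L w z \<longleftrightarrow> (\<exists>l<L. T3 (fst w) (snd w l) z)"

definition relay_decode :: "nat \<Rightarrow> (nat \<Rightarrow> 'x \<times> (nat \<Rightarrow> 'u)) \<Rightarrow> 'y \<Rightarrow> nat" where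
  "relay_decode M c y = (THE m. m \<in> {1..M} \<and> T1 (fst (c m)) y)"

definition decode :: "nat \<Rightarrow> nat \<Rightarrow> (nat \<Rightarrow> 'x \<times> (nat \<Rightarrow> 'u)) \<Rightarrow> 'z \<Rightarrow> nat option" where
  "decode L M c z = Some (THE m. m \<in> {1..M} \<and> accept L (c m) z)"

text \<open>In contrast to \<open>received\<close>, the relay here acts on the codeword of its own
  estimate \<open>relay_decode M c y\<close>.\<close>

definition code_error :: "nat \<Rightarrow> nat \<Rightarrow> (nat \<Rightarrow> 'x \<times> (nat \<Rightarrow> 'u)) \<Rightarrow> nat \<Rightarrow> real" where
  "code_error L M c m = measure_pmf.prob
     (bind_pmf (W2 (fst (c m))) (\<lambda>y. W3 (fst (c m)) (relay_symbol L (c (relay_decode M c y)) y) y))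
     {z. decode L M c z \<noteq> Some m}"

text \<open>If the sent codeword passes both tests and no other codeword passes either, then relay
  and receiver both decode correctly; the rest is the union bound.\<close>

lemma code_error_le:
  assumes m: "m \<in> {1..M}"
  shows "code_error L M c m \<le>
    (measure_pmf.prob (W2 (fst (c m))) {y. \<not> T1 (fst (c m)) y} +
     measure_pmf.prob (received L (c m)) {z. \<not> accept L (c m) z}) +
    (\<Sum>m' \<in> {1..M} - {m}. measure_pmf.prob (W2 (fst (c m))) {y. T1 (fst (c m')) y} +
       measure_pmf.prob (received L (c m)) {z. accept L (c m') z})"
proof -
  let ?x = "fst (c m)"
  let ?bad = "{y. relay_decode M c y \<noteq> m}"
  let ?err = "{z. decode L M c z \<noteq> Some m}"
  \<comment> \<open>Pretending that the relay knows \<open>m\<close> costs only the probability of its decoding error, and makes the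
     channel output independent of the codewords of the other messages.\<close>
  have "code_error L M c m \<le> measure_pmf.expectation (W2 ?x)
      (\<lambda>y. indicator ?bad y + measure_pmf.prob (W3 ?x (relay_symbol L (c m) y) y) ?err)"
    unfolding code_error_def prob_bind_pmf
  proof (rule integral_mono)
    show "measure_pmf.prob (W3 ?x (relay_symbol L (c (relay_decode M c y)) y) y) ?err \<le>
        indicator ?bad y + measure_pmf.prob (W3 ?x (relay_symbol L (c m) y) y) ?err" for y
      by (cases "y \<in> ?bad") (auto simp: add_increasing2)
  qed (auto intro!: Bochner_Integration.integrable_add measure_pmf.integrable_const_bound[where B =
      1 and f = "indicator ?bad"])
  also have "\<dots> = measure_pmf.prob (W2 ?x) ?bad + measure_pmf.prob (received L (c m)) ?err"
    unfolding received_def prob_bind_pmf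
    by (subst Bochner_Integration.integral_add)
       (auto intro!: measure_pmf.integrable_const_bound[where B = 1])
  also have "measure_pmf.prob (W2 ?x) ?bad \<le> measure_pmf.prob (W2 ?x)
      ({y. \<not> T1 ?x y} \<union> (\<Union>m'\<in>{1..M} - {m}. {y. T1 (fst (c m')) y}))"
  proof (rule measure_pmf.finite_measure_mono)
    have "relay_decode M c y = m" if "T1 ?x y" "\<forall>m'\<in>{1..M} - {m}. \<not> T1 (fst (c m')) y" for y
      unfolding relay_decode_def using that m by (intro the_equality) auto
    then show "?bad \<subseteq> {y. \<not> T1 ?x y} \<union> (\<Union>m'\<in>{1..M} - {m}. {y. T1 (fst (c m')) y})"
      by blast
  qed auto
  also have "\<dots> \<le> measure_pmf.prob (W2 ?x) {y. \<not> T1 ?x y} +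
      measure_pmf.prob (W2 ?x) (\<Union>m'\<in>{1..M} - {m}. {y. T1 (fst (c m')) y})"
    by (rule measure_Un_le) auto
  also have "measure_pmf.prob (W2 ?x) (\<Union>m'\<in>{1..M} - {m}. {y. T1 (fst (c m')) y}) \<le>
      (\<Sum>m'\<in>{1..M} - {m}. measure_pmf.prob (W2 ?x) {y. T1 (fst (c m')) y})"
    by (rule measure_UNION_le) auto
  also have "measure_pmf.prob (received L (c m)) ?err \<le> measure_pmf.prob (received L (c m))
      ({z. \<not> accept L (c m) z} \<union> (\<Union>m'\<in>{1..M} - {m}. {z. accept L (c m') z}))"
  proof (rule measure_pmf.finite_measure_mono)
    have "decode L M c z = Some m" if "accept L (c m) z" "\<forall>m'\<in>{1..M} - {m}. \<not> accept L (c m') z" for z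
      unfolding decode_def option.inject using that m by (intro the_equality) auto
    then show "?err \<subseteq> {z. \<not> accept L (c m) z} \<union> (\<Union>m'\<in>{1..M} - {m}. {z. accept L (c m') z})"
      by blast
  qed auto
  also have "\<dots> \<le> measure_pmf.prob (received L (c m)) {z. \<not> accept L (c m) z} +
      measure_pmf.prob (received L (c m)) (\<Union>m'\<in>{1..M} - {m}. {z. accept L (c m') z})"
    by (rule measure_Un_le) auto
  also have "measure_pmf.prob (received L (c m)) (\<Union>m'\<in>{1..M} - {m}. {z. accept L (c m') z}) \<le>
      (\<Sum>m'\<in>{1..M} - {m}. measure_pmf.prob (received L (c m)) {z. accept L (c m') z})"
    by (rule measure_UNION_le) auto
  finally show ?thesis by (simp add: sum.distrib algebra_simps)
qed

section \<open>Averaging over the random codebook\<close>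

lemma map_fst_codeword: "map_pmf fst (codeword L) = P"
  by (simp add: codeword_def map_bind_pmf map_pmf_comp bind_return_pmf')

text \<open>The \<open>L\<close> draws are independent, so all of them miss with probability (1 -
  r)^L, where r is the chance of a hit under \<open>PU x\<close>. By \<open>G_covering\<close>, r is
  at least \<open>a\<close> times the chance under \<open>V x y\<close>.\<close>

lemma prob_no_cover:
  "measure_pmf.prob (Pi_pmf {..<L} undefined (\<lambda>_. PU x)) {us. \<forall>l<L. \<not> G x (us l) y} \<le>
   measure_pmf.prob (V x y) {u. \<not> G x u y} + exp (- a * real L)"
proof -
  have compl: "measure_pmf.prob N {u. \<not> G x u y} = 1 - measure_pmf.prob N {u. G x u y}" for N :: "'u pmf"
    using measure_pmf.prob_compl[of "{u. G x u y}" N] by (simp add: Collect_neg_eq Compl_eq_Diff_UNIV)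
  have "{us. \<forall>l<L. \<not> G x (us l) y} = Pi {..<L} (\<lambda>_. {u. \<not> G x u y})"
    by (auto simp: Pi_def)
  then have "measure_pmf.prob (Pi_pmf {..<L} undefined (\<lambda>_. PU x)) {us. \<forall>l<L. \<not> G x (us l) y} =
      (1 - measure_pmf.prob (PU x) {u. G x u y}) ^ L"
    by (simp add: measure_Pi_pmf_Pi compl)
  also have "\<dots> \<le> (1 - measure_pmf.prob (V x y) {u. G x u y}) + exp (- a * real L)"
    by (rule one_minus_power_le_convex) (auto simp: a_nonneg G_covering)
  finally show ?thesis by (simp add: compl)
qed

text \<open>Either no auxiliary word meets the criterion \<open>G\<close>, or the selected one does
  and the receiver's test still fails, which \<open>T3_typical\<close> limits to \<delta>.\<close>

lemma expectation_not_accept: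
  "measure_pmf.expectation (codeword L) (\<lambda>w. measure_pmf.prob (received L w) {z. \<not> accept L w z})
   \<le> e2 + exp (- a * real L) + \<delta>"
proof -
  let ?miss = "\<lambda>w. {y. \<forall>l<L. \<not> G (fst w) (snd w l) y}"
  have *: "measure_pmf.prob (received L w) {z. \<not> accept L w z} \<le> measure_pmf.prob (W2 (fst w))
      (?miss w) + \<delta>" for w
    unfolding received_def
  proof (rule prob_bind_pmf_le_add)
    fix y assume "y \<notin> ?miss w"
    then obtain l where "l < L \<and> G (fst w) (snd w l) y" by auto
    then have l: "(SOME l. l < L \<and> G (fst w) (snd w l) y) < L \<and>
        G (fst w) (snd w (SOME l. l < L \<and> G (fst w) (snd w l) y)) y" by (rule someI)
    let ?l = "SOME l. l < L \<and> G (fst w) (snd w l) y"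
    have "measure_pmf.prob (W3 (fst w) (relay_symbol L w y) y) {z. \<not> accept L w z} \<le>
        measure_pmf.prob (W3 (fst w) (relay_symbol L w y) y) {z. \<not> T3 (fst w) (snd w ?l) z}"
      using l by (intro measure_pmf.finite_measure_mono) (auto simp: accept_def)
    also have "\<dots> \<le> \<delta>" unfolding relay_symbol_def using l by (intro T3_typical) auto
    finally show "measure_pmf.prob (W3 (fst w) (relay_symbol L w y) y) {z. \<not> accept L w z} \<le> \<delta>" .
  qed (rule \<delta>_nonneg)
  have "measure_pmf.expectation (codeword L) (\<lambda>w. measure_pmf.prob (received L w) {z. \<not> accept L w z}) \<le>
      measure_pmf.expectation (codeword L) (\<lambda>w. measure_pmf.prob (W2 (fst w)) (?miss w) + \<delta>)"
    by (rule integral_mono) (auto simp: * )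
  also have "\<dots> = measure_pmf.expectation (codeword L) (\<lambda>w. measure_pmf.prob (W2 (fst w)) (?miss w)) + \<delta>"
    by simp
  also have "measure_pmf.expectation (codeword L) (\<lambda>w. measure_pmf.prob (W2 (fst w)) (?miss w)) =
     measure_pmf.prob (bind_pmf (codeword L) (\<lambda>w. map_pmf (Pair w) (W2 (fst w)))) {(w, y). y \<in> ?miss w}"
    by (simp add: prob_bind_pmf vimage_def)
  also have "\<dots> = measure_pmf.expectation P (\<lambda>x. measure_pmf.expectation (Pi_pmf {..<L} undefined
      (\<lambda>_. PU x))
      (\<lambda>us. measure_pmf.prob (W2 x) {y. \<forall>l<L. \<not> G x (us l) y}))"
    by (simp add: codeword_def bind_assoc_pmf bind_map_pmf prob_bind_pmf vimage_def)
  \<comment> \<open>Given \<open>x\<close>, the auxiliary words and \<open>y\<close> are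
    independent. The order of averaging can be exchanged, and the covering bound then applies at
    each fixed pair of \<open>x\<close> and \<open>y\<close>.\<close>
  also have "\<dots> = measure_pmf.expectation P (\<lambda>x. measure_pmf.expectation (W2 x)
      (\<lambda>y. measure_pmf.prob (Pi_pmf {..<L} undefined (\<lambda>_. PU x)) {us. \<forall>l<L. \<not> G x (us l) y}))"
    by (subst expectation_prob_swap) simp
  also have "\<dots> \<le> measure_pmf.expectation P (\<lambda>x. measure_pmf.expectation (W2 x)
      (\<lambda>y. measure_pmf.prob (V x y) {u. \<not> G x u y} + exp (- a * real L)))"
    by (intro integral_mono prob_no_cover) auto
  also have "\<dots> = measure_pmf.expectation P (\<lambda>x. measure_pmf.expectation (W2 x)
      (\<lambda>y. measure_pmf.prob (V x y) {u. \<not> G x u y})) + exp (- a * real L)"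
    by simp
  finally show ?thesis using G_typical by simp
qed

text \<open>The law \<open>N\<close> of the output is arbitrary: the packing hypothesis is uniform
  in \<open>y\<close>, so \<open>y\<close> is fixed first and only the fresh codeword is
  random.\<close>

lemma expectation_T1_packing:
  "measure_pmf.expectation (codeword L) (\<lambda>w'. measure_pmf.prob N {y. T1 (fst w') y}) \<le> b1"
proof -
  have "measure_pmf.expectation (codeword L) (\<lambda>w'. measure_pmf.prob N {y. T1 (fst w') y}) =
      measure_pmf.expectation N (\<lambda>y. measure_pmf.prob (codeword L) {w'. T1 (fst w') y})"
    by (rule expectation_prob_swap)
  also have "\<dots> = measure_pmf.expectation N (\<lambda>y. measure_pmf.prob (map_pmf fst (codeword L)) {x. T1 x y})"
    by (simp add: vimage_def)
  also have "\<dots> \<le> b1"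
    unfolding map_fst_codeword by (rule expectation_prob_le) (rule T1_packing)
  finally show ?thesis .
qed

text \<open>Each of the \<open>L\<close> auxiliary words gives a pair with law \<open>P\<close>
  followed by \<open>PU\<close>, hence contributes at most \<open>b3\<close> at every fixed
  output.\<close>

lemma expectation_accept_packing:
  "measure_pmf.expectation (codeword L) (\<lambda>w'. measure_pmf.prob N {z. accept L w' z}) \<le> real L * b3"
proof -
  have "measure_pmf.prob (codeword L) {w'. accept L w' z} \<le> real L * b3" for z
  proof -
    have "measure_pmf.prob (codeword L) {w'. accept L w' z} \<le>
        measure_pmf.prob (codeword L) (\<Union>l\<in>{..<L}. {w'. T3 (fst w') (snd w' l) z})"
      by (rule measure_pmf.finite_measure_mono) (auto simp: accept_def)
    also have "\<dots> \<le> (\<Sum>l<L. measure_pmf.prob (codeword L) {w'. T3 (fst w') (snd w' l) z})"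
      by (rule measure_UNION_le) auto
    also have "\<dots> \<le> (\<Sum>l<L. b3)"
    proof (rule sum_mono)
      fix l assume l: "l \<in> {..<L}"
      have "measure_pmf.prob (codeword L) {w'. T3 (fst w') (snd w' l) z} =
        measure_pmf.expectation P (\<lambda>x. measure_pmf.prob
          (map_pmf (\<lambda>us. us l) (Pi_pmf {..<L} undefined (\<lambda>_. PU x))) {u. T3 x u z})"
        unfolding codeword_def prob_bind_pmf by (simp add: vimage_def)
      also have "\<dots> \<le> b3"
        using T3_packing[of z] l by (simp add: Pi_pmf_component del: measure_map_pmf)
      finally show "measure_pmf.prob (codeword L) {w'. T3 (fst w') (snd w' l) z} \<le> b3" .
    qed
    finally show ?thesis by simp
  qed
  then show ?thesis
    by (subst expectation_prob_swap) (rule expectation_prob_le)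
qed

text \<open>The expected error obeys the same bound for every message. Summing over messages before
  choosing a codebook yields one codebook that is good on average over all messages.\<close>

theorem exists_relay_code:
  "\<exists>enc rel dec. (\<Sum>m\<in>{1..M}. measure_pmf.prob
      (bind_pmf (W2 (enc m)) (\<lambda>y. W3 (enc m) (rel y) y)) {z. dec z \<noteq> Some m})
    \<le> real M * (e1 + e2 + exp (- a * real L) + \<delta> + real M * (b1 + real L * b3))"
proof -
  define C where "C = Pi_pmf {1..M} undefined (\<lambda>_. codeword L)"
  \<comment> \<open>Both constants dominate probabilities. Their signs justify enlarging the number
    of competing messages from M - 1 to M below.\<close>
  have b_nonneg: "0 \<le> b1" "0 \<le> b3"
    using order_trans[OF measure_nonneg T1_packing]
      order_trans[OF Bochner_Integration.integral_nonneg T3_packing] by auto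
  have E: "measure_pmf.expectation C (\<lambda>c. code_error L M c m) \<le>
      e1 + e2 + exp (- a * real L) + \<delta> + real M * (b1 + real L * b3)" if m: "m \<in> {1..M}" for m
  proof -
    have "measure_pmf.expectation C (\<lambda>c. code_error L M c m) \<le> measure_pmf.expectation C (\<lambda>c.
      (measure_pmf.prob (W2 (fst (c m))) {y. \<not> T1 (fst (c m)) y} +
       measure_pmf.prob (received L (c m)) {z. \<not> accept L (c m) z}) +
      (\<Sum>m' \<in> {1..M} - {m}. measure_pmf.prob (W2 (fst (c m))) {y. T1 (fst (c m')) y} +
         measure_pmf.prob (received L (c m)) {z. accept L (c m') z}))"
      by (intro integral_mono code_error_le m) (auto simp: code_error_def)
    also have "\<dots> = measure_pmf.expectation C (\<lambda>c. measure_pmf.prob (W2 (fst (c m)))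
        {y. \<not> T1 (fst (c m)) y}) +
       measure_pmf.expectation C (\<lambda>c. measure_pmf.prob (received L (c m)) {z. \<not> accept L (c m) z}) +
      (\<Sum>m' \<in> {1..M} - {m}. measure_pmf.expectation C (\<lambda>c. measure_pmf.prob (W2 (fst (c m)))
          {y. T1 (fst (c m')) y}) +
         measure_pmf.expectation C (\<lambda>c. measure_pmf.prob (received L (c m)) {z. accept L (c m') z}))"
      by simp
    also have "\<dots> \<le> e1 + (e2 + exp (- a * real L) + \<delta>) + (\<Sum>m' \<in> {1..M} - {m}. b1 + real L * b3)"
    proof (intro add_mono sum_mono)
      have "measure_pmf.expectation C (\<lambda>c. measure_pmf.prob (W2 (fst (c m))) {y. \<not> T1 (fst (c m)) y}) =
        measure_pmf.expectation (map_pmf fst (codeword L)) (\<lambda>x. measure_pmf.prob (W2 x) {y. \<not> T1 x y})"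
        unfolding C_def using m
        by (subst expectation_Pi_pmf_component[where g =
            "\<lambda>w. measure_pmf.prob (W2 (fst w)) {y. \<not> T1 (fst w) y}"]) auto
      then show "measure_pmf.expectation C (\<lambda>c. measure_pmf.prob (W2 (fst (c m)))
          {y. \<not> T1 (fst (c m)) y}) \<le> e1"
        using T1_typical by (simp only: map_fst_codeword)
      show "measure_pmf.expectation C (\<lambda>c. measure_pmf.prob (received L (c m)) {z. \<not> accept L (c m) z})
         \<le> e2 + exp (- a * real L) + \<delta>"
        unfolding C_def using m expectation_not_accept[of L]
        by (subst expectation_Pi_pmf_component[where g =
            "\<lambda>w. measure_pmf.prob (received L w) {z. \<not> accept L w z}"]) auto
      fix m' assume m': "m' \<in> {1..M} - {m}"
      show "measure_pmf.expectation C (\<lambda>c. measure_pmf.prob (W2 (fst (c m)))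
          {y. T1 (fst (c m')) y}) \<le> b1"
        unfolding C_def using m m'
        by (intro expectation_prob_Pi_pmf_two_components[where N = "\<lambda>w. W2 (fst w)" and A =
            "\<lambda>w'. {y. T1 (fst w') y}"]
            expectation_T1_packing) auto
      show "measure_pmf.expectation C (\<lambda>c. measure_pmf.prob (received L (c m))
          {z. accept L (c m') z}) \<le> real L * b3"
        unfolding C_def using m m'
        by (intro expectation_prob_Pi_pmf_two_components[where N = "received L" and A =
            "\<lambda>w'. {z. accept L w' z}"]
            expectation_accept_packing) auto
    qed
    also have "\<dots> \<le> e1 + (e2 + exp (- a * real L) + \<delta>) + real M * (b1 + real L * b3)"
      using m b_nonneg by (auto intro!: mult_right_mono)
    finally show ?thesis by simp
  qed
  have "\<exists>c. (\<Sum>m\<in>{1..M}. code_error L M c m) \<le>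
      real M * (e1 + e2 + exp (- a * real L) + \<delta> + real M * (b1 + real L * b3))"
  proof (rule exists_le_expectation_pmf[where p = C])
    show "integrable (measure_pmf C) (\<lambda>c. \<Sum>m\<in>{1..M}. code_error L M c m)"
      by (auto simp: code_error_def)
    have "measure_pmf.expectation C (\<lambda>c. \<Sum>m\<in>{1..M}. code_error L M c m) =
        (\<Sum>m\<in>{1..M}. measure_pmf.expectation C (\<lambda>c. code_error L M c m))"
      by (auto simp: code_error_def)
    also have "\<dots> \<le> (\<Sum>m\<in>{1..M}. e1 + e2 + exp (- a * real L) + \<delta> + real M * (b1 + real L * b3))"
      by (intro sum_mono E)
    finally show "measure_pmf.expectation C (\<lambda>c. \<Sum>m\<in>{1..M}. code_error L M c m) \<le>
      real M * (e1 + e2 + exp (- a * real L) + \<delta> + real M * (b1 + real L * b3))" by simp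
  qed
  then obtain c where "(\<Sum>m\<in>{1..M}. code_error L M c m) \<le>
      real M * (e1 + e2 + exp (- a * real L) + \<delta> + real M * (b1 + real L * b3))" ..
  then show ?thesis
    unfolding code_error_def
    by (intro exI[of _ "\<lambda>m. fst (c m)"] exI[of _ "\<lambda>y. relay_symbol L (c (relay_decode M c y)) y"]
        exI[of _ "decode L M c"])
qed

end

section \<open>Information densities of product distributions\<close>

definition info_density :: "('a \<times> 'b) pmf \<Rightarrow> 'a \<times> 'b \<Rightarrow> real" where
  "info_density R r = log 2 (pmf R r / (pmf (map_pmf fst R) (fst r) * pmf (map_pmf snd R) (snd r)))"

lemma mutual_info_eq_expectation:
  fixes R :: "('a::finite \<times> 'b::finite) pmf"
  shows "mutual_info R = measure_pmf.expectation R (info_density R)"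
  unfolding mutual_info_def
  by (subst integral_measure_pmf_real[where A = "set_pmf R"])
     (auto simp: info_density_def case_prod_unfold mult.commute)

text \<open>The test is multiplicative and strict so that it fails whenever a factor on the right vanishes.\<close>

definition likely :: "nat \<Rightarrow> ('a \<times> 'b) pmf \<Rightarrow> real \<Rightarrow> (nat \<Rightarrow> 'a \<times> 'b) \<Rightarrow> bool" where
  "likely n R c g \<longleftrightarrow>
     c * (\<Prod>i<n. pmf (map_pmf fst R) (fst (g i)) * pmf (map_pmf snd R) (snd (g i))) < (\<Prod>i<n. pmf R (g i))"

text \<open>Blocks are stored as functions with value \<open>undefined\<close> off the block; the
  test does not see those values.\<close>

lemma likely_cong:
  assumes "\<And>i. i < n \<Longrightarrow> g i = g' i"
  shows "likely n R c g = likely n R c g'"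
proof -
  have "(\<Prod>i<n. F (g i)) = (\<Prod>i<n. F (g' i))" for F :: "'a \<times> 'b \<Rightarrow> real"
    using assms by (intro prod.cong) auto
  from this[of "pmf R"] this[of "\<lambda>r. pmf (map_pmf fst R) (fst r) * pmf (map_pmf snd R) (snd r)"]
  show ?thesis unfolding likely_def by simp
qed

text \<open>Letters with vanishing first marginal also have vanishing joint pmf, so division by zero
  loses nothing and the weights cancel.\<close>

lemma expectation_pmf_ratio:
  fixes R :: "('a::finite \<times> 'b) pmf"
  shows "measure_pmf.expectation (map_pmf fst R) (\<lambda>a. pmf R (a, b) / pmf (map_pmf fst R) a) =
      pmf (map_pmf snd R) b"
proof -
  have zero: "pmf R (a, b) = 0" if "pmf (map_pmf fst R) a = 0" for a
    using that by (force simp: pmf_eq_0_set_pmf)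
  have "measure_pmf.expectation (map_pmf fst R) (\<lambda>a. pmf R (a, b) / pmf (map_pmf fst R) a) =
      (\<Sum>a\<in>UNIV. pmf R (a, b) / pmf (map_pmf fst R) a * pmf (map_pmf fst R) a)"
    by (rule integral_measure_pmf_real) auto
  also have "\<dots> = (\<Sum>a\<in>UNIV. pmf R (a, b))"
    by (rule sum.cong) (auto simp: zero)
  also have "\<dots> = (\<Sum>r\<in>(\<lambda>a. (a, b)) ` UNIV. pmf R r)"
    by (subst sum.reindex) (auto simp: inj_on_def)
  also have "\<dots> = measure_pmf.prob R ((\<lambda>a. (a, b)) ` UNIV)"
    by (rule measure_measure_pmf_finite[symmetric]) auto
  also have "(\<lambda>a. (a, b)) ` UNIV = snd -` {b}" by auto
  also have "measure_pmf.prob R (snd -` {b}) = pmf (map_pmf snd R) b"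
    by (simp add: pmf_map)
  finally show ?thesis .
qed

text \<open>Under independently drawn \<open>as\<close>, the likelihood ratio of the block has mean
  1 for each fixed \<open>bs\<close>; Markov's inequality then gives 1 / c.\<close>

lemma prob_likely_packing:
  fixes R :: "('a::finite \<times> 'b) pmf"
  assumes "0 < c"
  shows "measure_pmf.prob (Pi_pmf {..<n} undefined (\<lambda>_. map_pmf fst R))
    {as. likely n R c (\<lambda>i. (as i, bs i))} \<le> 1 / c"
proof (cases "\<exists>i<n. pmf (map_pmf snd R) (bs i) = 0")
  \<comment> \<open>A letter outside the support of the second marginal makes the joint product
    zero, and the strict test rejects. The other case may then divide by \<open>q\<close>.\<close>
  case True
  then obtain i where i: "i < n" "pmf (map_pmf snd R) (bs i) = 0" by auto
  then have "pmf R (a, bs i) = 0" for a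
    by (force simp: pmf_eq_0_set_pmf)
  then have "\<not> likely n R c (\<lambda>i. (as i, bs i))" for as
  proof -
    have "(\<Prod>i<n. pmf R (as i, bs i)) = 0" using i \<open>\<And>a. pmf R (a, bs i) = 0\<close> by (intro prod_zero) auto
    moreover have "0 \<le> c * (\<Prod>i<n. pmf (map_pmf fst R) (as i) * pmf (map_pmf snd R) (bs i))"
      using assms by (intro mult_nonneg_nonneg prod_nonneg) auto
    ultimately show ?thesis
      by (simp only: likely_def not_less fst_conv snd_conv)
  qed
  then show ?thesis using assms by simp
next
  case False
  let ?A = "map_pmf fst R"
  let ?M = "Pi_pmf {..<n} undefined (\<lambda>_. ?A)"
  let ?S = "{as. likely n R c (\<lambda>i. (as i, bs i))}"
  let ?r = "\<lambda>i a. pmf R (a, bs i) / pmf ?A a"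
  define q where "q = (\<Prod>i<n. pmf (map_pmf snd R) (bs i))"
  have q: "0 < q" unfolding q_def using False by (intro prod_pos) (auto simp: less_le)
  have "measure_pmf.prob ?M ?S = measure_pmf.expectation ?M (indicator ?S)" by simp
  also have "\<dots> \<le> measure_pmf.expectation ?M (\<lambda>as. (\<Prod>i<n. ?r i (as i)) / (c * q))"
  proof (rule integral_mono_AE)
    show "integrable (measure_pmf ?M) (\<lambda>as. (\<Prod>i<n. ?r i (as i)) / (c * q))"
      by (intro integrable_divide integrable_prod_Pi_pmf integrable_measure_pmf_finite) auto
    have "indicator ?S as \<le> (\<Prod>i<n. ?r i (as i)) / (c * q)" if "as \<in> set_pmf ?M" for as
    proof (cases "as \<in> ?S")
      case True
      have pos: "0 < pmf ?A (as i)" if "i < n" for i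
        using \<open>as \<in> set_pmf ?M\<close> that by (auto simp: set_Pi_pmf PiE_dflt_def pmf_positive_iff
            simp del: set_map_pmf)
      define p where "p = (\<Prod>i<n. pmf ?A (as i))"
      have p: "0 < p" unfolding p_def using pos by (intro prod_pos) auto
      have "c * (p * q) < (\<Prod>i<n. pmf R (as i, bs i))"
        using True by (simp add: likely_def p_def q_def prod.distrib)
      then have "1 \<le> (\<Prod>i<n. pmf R (as i, bs i)) / p / (c * q)"
        using p q assms by (simp add: field_simps)
      then show ?thesis using True by (simp add: p_def prod_dividef)
    qed (use q assms in \<open>auto intro!: divide_nonneg_nonneg prod_nonneg\<close>)
    then show "AE as in measure_pmf ?M. indicator ?S as \<le> (\<Prod>i<n. ?r i (as i)) / (c * q)"
      by (simp add: AE_measure_pmf_iff)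
  qed (auto intro!: measure_pmf.integrable_const_bound[where B = 1])
  also have "\<dots> = measure_pmf.expectation ?M (\<lambda>as. \<Prod>i<n. ?r i (as i)) / (c * q)" by simp
  also have "measure_pmf.expectation ?M (\<lambda>as. \<Prod>i<n. ?r i (as i)) =
      (\<Prod>i<n. measure_pmf.expectation ?A (?r i))"
    by (intro expectation_prod_Pi_pmf integrable_measure_pmf_finite) auto
  also have "\<dots> = q" unfolding q_def by (simp only: expectation_pmf_ratio)
  finally show ?thesis using q by simp
qed

text \<open>On the support every factor is positive, so logarithms turn the multiplicative test into
  a threshold on a sum of i.i.d. information densities.\<close>

lemma prob_not_likely_le:
  assumes "0 < c"
  shows "measure_pmf.prob (Pi_pmf {..<n} undefined (\<lambda>_. R)) {g. \<not> likely n R c g} \<le>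
    measure_pmf.prob (Pi_pmf {..<n} undefined (\<lambda>_. R)) {g. (\<Sum>i<n. info_density R (g i)) \<le> log 2 c}"
proof (rule measure_pmf.finite_measure_mono_AE)
  have "(\<Sum>i<n. info_density R (g i)) \<le> log 2 c"
    if g: "g \<in> set_pmf (Pi_pmf {..<n} undefined (\<lambda>_. R))" and nl: "\<not> likely n R c g" for g
  proof -
    have mem: "g i \<in> set_pmf R" if "i < n" for i
      using g that by (auto simp: set_Pi_pmf PiE_dflt_def)
    have pos: "0 < pmf R (g i)" "0 < pmf (map_pmf fst R) (fst (g i)) * pmf (map_pmf snd R)
        (snd (g i))" if "i < n" for i
      using mem[OF that] by (auto simp: pmf_positive_iff intro!: mult_pos_pos)
    let ?p = "\<Prod>i<n. pmf R (g i)"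
    let ?q = "\<Prod>i<n. pmf (map_pmf fst R) (fst (g i)) * pmf (map_pmf snd R) (snd (g i))"
    have q: "0 < ?q" "0 < ?p" using pos by (auto intro!: prod_pos)
    have "(\<Sum>i<n. info_density R (g i)) = log 2 (\<Prod>i<n. pmf R (g i) / (pmf (map_pmf fst R)
        (fst (g i)) * pmf (map_pmf snd R) (snd (g i))))"
      unfolding info_density_def log_def using pos
      by (subst ln_prod) (force simp: sum_divide_distrib)+
    also have "\<dots> = log 2 (?p / ?q)" by (simp only: prod_dividef)
    also have "\<dots> \<le> log 2 c"
      using nl q assms by (intro log_mono) (auto simp: likely_def not_less divide_le_eq)
    finally show ?thesis .
  qed
  then show "AE g in measure_pmf (Pi_pmf {..<n} undefined (\<lambda>_. R)). g \<in> {g. \<not> likely n R c g} \<longrightarrow>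
      g \<in> {g. (\<Sum>i<n. info_density R (g i)) \<le> log 2 c}"
    by (simp add: AE_measure_pmf_iff)
qed auto

section \<open>Block codes\<close>

lemma sum_lists_eq_expectation_Pi_pmf:
  fixes p :: "nat \<Rightarrow> 'a::finite pmf" and F :: "'a list \<Rightarrow> real"
  shows "(\<Sum>ys\<in>{ys. length ys = n}. (\<Prod>i<n. pmf (p i) (ys ! i)) * F ys) =
    measure_pmf.expectation (Pi_pmf {..<n} undefined p) (\<lambda>g. F (map g [0..<n]))"
proof -
  let ?M = "Pi_pmf {..<n} undefined p"
  let ?N = "map_pmf (\<lambda>g. map g [0..<n]) ?M"
  have "measure_pmf.expectation ?M (\<lambda>g. F (map g [0..<n])) = measure_pmf.expectation ?N F" by simp
  also have "\<dots> = (\<Sum>ys\<in>{ys. length ys = n}. F ys * pmf ?N ys)"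
    by (rule integral_measure_pmf_real)
       (use finite_lists_length_eq[of "UNIV :: 'a set" n] in auto)
  also have "\<dots> = (\<Sum>ys\<in>{ys. length ys = n}. (\<Prod>i<n. pmf (p i) (ys ! i)) * F ys)"
  proof (rule sum.cong)
    fix ys :: "'a list" assume ys: "ys \<in> {ys. length ys = n}"
    have "(\<lambda>g. map g [0..<n]) -` {ys} = Pi {..<n} (\<lambda>i. {ys ! i})"
    proof (rule set_eqI)
      have "map g [0..<n] = ys \<longleftrightarrow> (\<forall>i<n. g i = ys ! i)" for g
        using ys unfolding list_eq_iff_nth_eq by simp
      then show "g \<in> (\<lambda>g. map g [0..<n]) -` {ys} \<longleftrightarrow> g \<in> Pi {..<n} (\<lambda>i. {ys ! i})" for g
        by (simp add: Pi_def)
    qed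
    then have "pmf ?N ys = (\<Prod>i<n. pmf (p i) (ys ! i))"
      by (simp add: pmf_map measure_Pi_pmf_Pi measure_pmf_single)
    then show "F ys * pmf ?N ys = (\<Prod>i<n. pmf (p i) (ys ! i)) * F ys" by simp
  qed simp
  finally show ?thesis by simp
qed

text \<open>The value off the block equals the default of the product distributions, so that this
  inverts \<open>map g [0..<n]\<close> on their support.\<close>

definition list_to_fun :: "nat \<Rightarrow> 'a list \<Rightarrow> nat \<Rightarrow> 'a" where
  "list_to_fun n ys i = (if i < n then ys ! i else undefined)"

lemma list_to_fun_map:
  "g \<in> set_pmf (Pi_pmf {..<n} undefined p) \<Longrightarrow> list_to_fun n (map g [0..<n]) = g"
  by (auto simp: fun_eq_iff list_to_fun_def set_Pi_pmf PiE_dflt_def)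

text \<open>It transfers codes acting on functions, as produced by the one-shot bound, to codes
  acting on lists, as required by \<open>error_prob\<close>.\<close>

lemma error_prob_list_to_fun:
  fixes W2 :: "'x1 \<Rightarrow> 'y2::finite pmf" and W3 :: "'x1 \<Rightarrow> 'x2 \<Rightarrow> 'y2 \<Rightarrow> 'y3::finite pmf"
    and enc :: "nat \<Rightarrow> nat \<Rightarrow> 'x1"
  shows "error_prob W2 W3 n M enc (\<lambda>i ys. rel (list_to_fun n ys) i) (\<lambda>zs. dec (list_to_fun n zs)) =
    1 / real M * (\<Sum>m\<in>{1..M}. measure_pmf.prob
       (bind_pmf (Pi_pmf {..<n} undefined (\<lambda>i. W2 (enc m i)))
          (\<lambda>ys. Pi_pmf {..<n} undefined (\<lambda>i. W3 (enc m i) (rel ys i) (ys i))))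
       {zs. dec zs \<noteq> Some m})"
proof -
  have "(\<Sum>y2s \<in> {ys. length ys = n}. \<Sum>y3s \<in> {ys. length ys = n}.
          (\<Prod>i<n. pmf (W2 (enc m i)) (y2s ! i)) *
          (\<Prod>i<n. pmf (W3 (enc m i) (rel (list_to_fun n y2s) i) (y2s ! i)) (y3s ! i)) *
          (if dec (list_to_fun n y3s) = Some m then 0 else 1)) =
     measure_pmf.prob
       (bind_pmf (Pi_pmf {..<n} undefined (\<lambda>i. W2 (enc m i)))
          (\<lambda>ys. Pi_pmf {..<n} undefined (\<lambda>i. W3 (enc m i) (rel ys i) (ys i))))
       {zs. dec zs \<noteq> Some m}" (is "?lhs = ?rhs") for m
  proof -
    let ?K = "\<lambda>ys. Pi_pmf {..<n} undefined (\<lambda>i. W3 (enc m i) (rel (list_to_fun n ys) i) (ys ! i))"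
    have inner: "(\<Sum>y3s \<in> {ys. length ys = n}. (\<Prod>i<n. pmf (W3 (enc m i) (rel (list_to_fun n y2s) i)
        (y2s ! i)) (y3s ! i)) *
          (if dec (list_to_fun n y3s) = Some m then 0 else 1)) =
              measure_pmf.prob (?K y2s) {zs. dec zs \<noteq> Some m}" for y2s
    proof -
      have "(\<Sum>y3s \<in> {ys. length ys = n}. (\<Prod>i<n. pmf (W3 (enc m i) (rel (list_to_fun n y2s) i)
          (y2s ! i)) (y3s ! i)) *
          (if dec (list_to_fun n y3s) = Some m then 0 else 1)) =
        measure_pmf.expectation (?K y2s) (\<lambda>g. if dec (list_to_fun n (map g [0..<n])) =
            Some m then 0 else 1)"
        by (rule sum_lists_eq_expectation_Pi_pmf)
      \<comment> \<open>The two integrands agree only for functions that are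
        \<open>undefined\<close> off the block, hence almost everywhere.\<close>
      also have "\<dots> = measure_pmf.expectation (?K y2s) (indicator {zs. dec zs \<noteq> Some m})"
        by (rule integral_cong_AE) (auto simp: AE_measure_pmf_iff list_to_fun_map)
      finally show ?thesis by simp
    qed
    have "?lhs = (\<Sum>y2s \<in> {ys. length ys = n}. (\<Prod>i<n. pmf (W2 (enc m i)) (y2s ! i)) *
        measure_pmf.prob (?K y2s) {zs. dec zs \<noteq> Some m})"
      by (simp add: mult.assoc sum_distrib_left[symmetric] inner)
    also have "\<dots> = measure_pmf.expectation (Pi_pmf {..<n} undefined (\<lambda>i. W2 (enc m i)))
        (\<lambda>g. measure_pmf.prob (?K (map g [0..<n])) {zs. dec zs \<noteq> Some m})"
      by (rule sum_lists_eq_expectation_Pi_pmf)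
    also have "\<dots> = measure_pmf.expectation (Pi_pmf {..<n} undefined (\<lambda>i. W2 (enc m i)))
        (\<lambda>ys. measure_pmf.prob (Pi_pmf {..<n} undefined (\<lambda>i. W3 (enc m i) (rel ys i)
            (ys i))) {zs. dec zs \<noteq> Some m})"
    proof (rule integral_cong_AE)
      have "?K (map g [0..<n]) = Pi_pmf {..<n} undefined (\<lambda>i. W3 (enc m i) (rel g i) (g i))"
        if "g \<in> set_pmf (Pi_pmf {..<n} undefined (\<lambda>i. W2 (enc m i)))" for g
        using that by (intro Pi_pmf_cong) (auto simp: list_to_fun_map)
      then show "AE g in measure_pmf (Pi_pmf {..<n} undefined (\<lambda>i. W2 (enc m i))).
          measure_pmf.prob (?K (map g [0..<n])) {zs. dec zs \<noteq> Some m} =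
          measure_pmf.prob (Pi_pmf {..<n} undefined (\<lambda>i. W3 (enc m i) (rel g i)
              (g i))) {zs. dec zs \<noteq> Some m}"
        by (simp add: AE_measure_pmf_iff)
    qed auto
    also have "\<dots> = ?rhs" by (simp add: prob_bind_pmf)
    finally show ?thesis .
  qed
  then show ?thesis unfolding error_prob_def by (simp only:)
qed

abbreviation block_pmf :: "nat \<Rightarrow> (nat \<Rightarrow> 'a pmf) \<Rightarrow> (nat \<Rightarrow> 'a) pmf" where
  "block_pmf n p \<equiv> Pi_pmf {..<n} undefined p"

section \<open>Marginals of the relay distribution and their block versions\<close>

lemma relay_joint_x1_y2:
  "map_pmf (\<lambda>(x1, u, y2, x2, y3). (x1, y2)) (relay_joint W2 W3 P Q f) =
   bind_pmf P (\<lambda>x. map_pmf (Pair x) (W2 x))"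
  by (simp add: relay_joint_def map_bind_pmf map_pmf_comp) (simp add: map_pmf_def)

lemma relay_joint_x1u_y3:
  "map_pmf (\<lambda>(x1, u, y2, x2, y3). ((x1, u), y3)) (relay_joint W2 W3 P Q f) =
   bind_pmf P (\<lambda>x. bind_pmf (W2 x) (\<lambda>y. bind_pmf (Q x y) (\<lambda>u. map_pmf (\<lambda>z. ((x, u), z))
       (W3 x (f u x y) y))))"
  by (simp add: relay_joint_def map_bind_pmf map_pmf_comp)

lemma relay_joint_x1_u:
  "map_pmf fst (map_pmf (\<lambda>(x1, u, y2, x2, y3). ((x1, u), y3)) (relay_joint W2 W3 P Q f)) =
   bind_pmf P (\<lambda>x. map_pmf (Pair x) (bind_pmf (W2 x) (Q x)))"
  by (simp add: relay_joint_def map_bind_pmf map_pmf_comp) (simp add: map_pmf_def)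

text \<open>Memorylessness: drawing pairs independently over time is the same as drawing the whole
  first block and then passing it through the product kernel.\<close>

lemma block_pmf_pair:
  "block_pmf n (\<lambda>_. bind_pmf P (\<lambda>x. map_pmf (Pair x) (K x))) =
   bind_pmf (block_pmf n (\<lambda>_. P)) (\<lambda>xs. map_pmf (\<lambda>ys i. if i < n then (xs i, ys i) else undefined)
     (block_pmf n (\<lambda>i. K (xs i))))"
  by (simp add: map_pmf_def Pi_pmf_bind[where d' = undefined])

lemma block_pmf_triple:
  "block_pmf n (\<lambda>_. bind_pmf P (\<lambda>x. bind_pmf (W2 x) (\<lambda>y. map_pmf (\<lambda>u. (x, u, y)) (Q x y)))) =
   bind_pmf (block_pmf n (\<lambda>_. P)) (\<lambda>xs. bind_pmf (block_pmf n (\<lambda>i. W2 (xs i))) (\<lambda>ys.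
     map_pmf (\<lambda>us i. if i < n then (xs i, us i, ys i) else undefined) (block_pmf n (\<lambda>i. Q (xs i)
         (ys i)))))"
  by (simp add: map_pmf_def Pi_pmf_bind[where d' = undefined])

lemma block_pmf_quadruple:
  "block_pmf n (\<lambda>_. bind_pmf P (\<lambda>x. bind_pmf (W2 x) (\<lambda>y. bind_pmf (Q x y)
      (\<lambda>u. map_pmf (\<lambda>z. ((x, u), z)) (K x u y))))) =
   bind_pmf (block_pmf n (\<lambda>_. P)) (\<lambda>xs. bind_pmf (block_pmf n (\<lambda>i. W2 (xs i))) (\<lambda>ys.
     bind_pmf (block_pmf n (\<lambda>i. Q (xs i) (ys i))) (\<lambda>us.
     map_pmf (\<lambda>zs i. if i < n then ((xs i, us i), zs i) else undefined) (block_pmf n (\<lambda>i. K (xs i)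
         (us i) (ys i))))))"
  by (simp add: map_pmf_def Pi_pmf_bind[where d' = undefined])

section \<open>The conditional information density\<close>

definition relay_xuy :: "'x pmf \<Rightarrow> ('x \<Rightarrow> 'y pmf) \<Rightarrow> ('x \<Rightarrow> 'y \<Rightarrow> 'u pmf) \<Rightarrow> ('x \<times> 'u \<times> 'y) pmf" where
  "relay_xuy P W2 Q = bind_pmf P (\<lambda>x. bind_pmf (W2 x) (\<lambda>y. map_pmf (\<lambda>u. (x, u, y)) (Q x y)))"

text \<open>The density of I(U;Y2|X1) in the form log p(u|x,y) / p(u|x), which is the likelihood
  ratio between the two laws compared in the covering step.\<close>

definition cond_info_density :: "('x \<Rightarrow> 'y pmf) \<Rightarrow> ('x \<Rightarrow> 'y \<Rightarrow> 'u pmf) \<Rightarrow> 'x \<times> 'u \<times> 'y \<Rightarrow> real" where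
  "cond_info_density W2 Q = (\<lambda>(x, u, y). log 2 (pmf (Q x y) u / pmf (bind_pmf (W2 x) (Q x)) u))"

lemma relay_joint_u_y2_x1:
  "map_pmf (\<lambda>(x1, u, y2, x2, y3). (u, y2, x1)) (relay_joint W2 W3 P Q f) =
   map_pmf (\<lambda>(x, u, y). (u, y, x)) (relay_xuy P W2 Q)"
  by (simp add: relay_joint_def relay_xuy_def map_bind_pmf map_pmf_comp) (simp add: map_pmf_def)

lemma pmf_relay_xuy: "pmf (relay_xuy P W2 Q) (x, u, y) = pmf P x * pmf (W2 x) y * pmf (Q x y) u"
proof -
  let ?N = "bind_pmf (bind_pmf P (\<lambda>x. map_pmf (Pair x) (W2 x))) (\<lambda>xy. map_pmf (Pair xy)
      (Q (fst xy) (snd xy)))"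
  have "relay_xuy P W2 Q = map_pmf (\<lambda>((x, y), u). (x, u, y)) ?N"
    unfolding relay_xuy_def by (simp add: map_bind_pmf map_pmf_comp bind_assoc_pmf bind_map_pmf)
  also have "pmf \<dots> (x, u, y) = pmf ?N ((x, y), u)"
    using pmf_map_inj'[of "\<lambda>((x, y), u). (x, u, y)" ?N "((x, y), u)"] by (auto simp: inj_def)
  also have "\<dots> = pmf P x * pmf (W2 x) y * pmf (Q x y) u"
    by (simp only: pmf_bind_map_Pair fst_conv snd_conv)
  finally show ?thesis .
qed

lemma relay_xuy_pos:
  assumes "(x, u, y) \<in> set_pmf (relay_xuy P W2 Q)"
  shows "0 < pmf P x" "0 < pmf (W2 x) y" "0 < pmf (Q x y) u" "0 < pmf (bind_pmf (W2 x) (Q x)) u"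
  using assms unfolding relay_xuy_def by (auto simp: pmf_positive_iff)

text \<open>By the factorization p(x) p(y|x) p(u|x,y), the factors p(x) and p(y|x) cancel on the
  support.\<close>

lemma cond_mutual_info_eq_expectation:
  fixes W2 :: "'x1::finite \<Rightarrow> 'y2::finite pmf" and Q :: "'x1 \<Rightarrow> 'y2 \<Rightarrow> 'u::finite pmf"
  shows "cond_mutual_info (map_pmf (\<lambda>(x1, u, y2, x2, y3). (u, y2, x1)) (relay_joint W2 W3 P Q f)) =
    measure_pmf.expectation (relay_xuy P W2 Q) (cond_info_density W2 Q)"
proof -
  define T where "T = map_pmf (\<lambda>(x1, u, y2, x2, y3). (u, y2, x1)) (relay_joint W2 W3 P Q f)"
  have T: "T = map_pmf (\<lambda>(x, u, y). (u, y, x)) (relay_xuy P W2 Q)"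
    unfolding T_def by (rule relay_joint_u_y2_x1)
  have pT: "pmf T (u, y, x) = pmf P x * pmf (W2 x) y * pmf (Q x y) u" for u y x
    using pmf_map_inj'[of "\<lambda>(x, u, y). (u, y, x)" "relay_xuy P W2 Q" "(x, u, y)"]
    by (auto simp: T inj_def pmf_relay_xuy)
  have m3: "map_pmf (\<lambda>(a, b, c). c) T = P"
    by (simp add: T relay_xuy_def map_pmf_comp case_prod_unfold map_bind_pmf bind_return_pmf')
  have m13: "map_pmf (\<lambda>(a, b, c). (a, c)) T = map_pmf prod.swap (bind_pmf P (\<lambda>x. map_pmf (Pair x)
      (bind_pmf (W2 x) (Q x))))"
    by (simp add: T relay_xuy_def map_pmf_comp case_prod_unfold map_bind_pmf bind_assoc_pmf bind_map_pmf)
  have m23: "map_pmf (\<lambda>(a, b, c). (b, c)) T = map_pmf prod.swap (bind_pmf P (\<lambda>x. map_pmf (Pair x)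
      (W2 x)))"
    by (simp add: T relay_xuy_def map_pmf_comp case_prod_unfold map_bind_pmf bind_assoc_pmf
        bind_map_pmf) (simp add: map_pmf_def)
  have swap: "pmf (map_pmf prod.swap N) (b, a) = pmf N (a, b)" for N :: "('c \<times> 'd) pmf" and a b
    using pmf_map_inj'[of prod.swap N "(a, b)"] by simp
  let ?d = "\<lambda>(a, b, c). log 2 (pmf T (a, b, c) * pmf (map_pmf (\<lambda>(a, b, c). c) T) c /
               (pmf (map_pmf (\<lambda>(a, b, c). (a, c)) T) (a, c) * pmf (map_pmf (\<lambda>(a, b, c). (b, c)) T)
                   (b, c)))"
  have "cond_mutual_info T = measure_pmf.expectation T ?d"
    unfolding cond_mutual_info_def
    by (subst integral_measure_pmf_real[where A = "set_pmf T"])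
        (auto simp: case_prod_unfold mult.commute)
  also have "\<dots> = measure_pmf.expectation (relay_xuy P W2 Q) (\<lambda>r. ?d ((\<lambda>(x, u, y). (u, y, x)) r))"
    by (subst (1) T) simp
  also have "\<dots> = measure_pmf.expectation (relay_xuy P W2 Q) (cond_info_density W2 Q)"
  proof (rule integral_cong_AE)
    have "?d ((\<lambda>(x, u, y). (u, y, x)) r) =
        cond_info_density W2 Q r" if "r \<in> set_pmf (relay_xuy P W2 Q)" for r
    proof -
      obtain x u y where r: "r = (x, u, y)" by (cases r) auto
      note pos = relay_xuy_pos[OF that[unfolded r]]
      show ?thesis
        unfolding r cond_info_density_def prod.case m3 m13 m23 swap pmf_bind_map_Pair pT
        using pos by (simp add: field_simps)
    qed
    then show "AE r in measure_pmf (relay_xuy P W2 Q). ?d ((\<lambda>(x, u, y). (u, y, x)) r) =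
        cond_info_density W2 Q r"
      by (simp only: AE_measure_pmf_iff) blast
  qed auto
  finally show ?thesis unfolding T_def .
qed

text \<open>The usual argument from ln s \<le> s - 1. It ensures later that the exponent defining
  the number of auxiliary words is nonnegative.\<close>

lemma expectation_cond_info_density_nonneg:
  fixes W2 :: "'x1::finite \<Rightarrow> 'y2::finite pmf" and Q :: "'x1 \<Rightarrow> 'y2 \<Rightarrow> 'u::finite pmf"
  shows "0 \<le> measure_pmf.expectation (relay_xuy P W2 Q) (cond_info_density W2 Q)"
proof -
  let ?N = "relay_xuy P W2 Q"
  let ?r = "\<lambda>(x, u, y). pmf (bind_pmf (W2 x) (Q x)) u / pmf (Q x y) u"
  have fin: "integrable (measure_pmf ?N) h" for h :: "_ \<Rightarrow> real"
    by (rule integrable_measure_pmf_finite) simp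
  have "measure_pmf.expectation ?N ?r = (\<Sum>t\<in>UNIV. ?r t * pmf ?N t)"
    by (rule integral_measure_pmf_real) auto
  \<comment> \<open>Only an inequality: terms with \<open>pmf (Q x y) u = 0\<close> vanish on the
    left but may be positive on the right.\<close>
  also have "\<dots> \<le> (\<Sum>(x, u, y)\<in>UNIV. pmf P x * pmf (W2 x) y * pmf (bind_pmf (W2 x) (Q x)) u)"
    by (rule sum_mono) (auto simp: pmf_relay_xuy)
  also have "\<dots> = (\<Sum>x\<in>UNIV. \<Sum>u\<in>UNIV. \<Sum>y\<in>UNIV. pmf P x * pmf (W2 x) y * pmf (bind_pmf (W2 x) (Q x)) u)"
    by (simp add: sum.cartesian_product UNIV_Times_UNIV[symmetric] del: UNIV_Times_UNIV)
  also have "\<dots> = 1"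
    by (simp add: sum_distrib_left[symmetric] sum_distrib_right[symmetric] sum_pmf_eq_1)
  finally have le1: "measure_pmf.expectation ?N ?r \<le> 1" .
  have "0 \<le> measure_pmf.expectation ?N (\<lambda>t. (1 - ?r t) / ln 2)"
    using le1 by (simp add: fin)
  also have "\<dots> \<le> measure_pmf.expectation ?N (cond_info_density W2 Q)"
  proof (rule integral_mono_AE[OF fin fin])
    have "(1 - ?r t) / ln 2 \<le> cond_info_density W2 Q t" if "t \<in> set_pmf ?N" for t
    proof -
      obtain x u y where t: "t = (x, u, y)" by (cases t) auto
      note pos = relay_xuy_pos[OF that[unfolded t]]
      let ?s = "pmf (bind_pmf (W2 x) (Q x)) u / pmf (Q x y) u"
      have "ln ?s \<le> ?s - 1" using pos by (intro ln_le_minus_one) simp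
      moreover have "ln (pmf (Q x y) u / pmf (bind_pmf (W2 x) (Q x)) u) = - ln ?s"
        using pos by (simp add: ln_div)
      ultimately show ?thesis
        unfolding t cond_info_density_def log_def prod.case by (intro divide_right_mono) auto
    qed
    then show "AE t in measure_pmf ?N. (1 - ?r t) / ln 2 \<le> cond_info_density W2 Q t"
      by (simp add: AE_measure_pmf_iff)
  qed
  finally show ?thesis .
qed

section \<open>The one-shot bound for product distributions\<close>

text \<open>The letters of the one-shot bound become blocks of length \<open>n\<close>. The numbers
  \<open>e1\<close>, \<open>e2\<close>, \<open>e3\<close> bound the tail events of the three
  information densities, with thresholds \<open>c1\<close>, \<open>c2\<close>,
  \<open>c3\<close>.\<close>

lemma exists_block_code:
  fixes W2 :: "'x1::finite \<Rightarrow> 'y2::finite pmf" and W3 :: "'x1 \<Rightarrow> 'x2::finite \<Rightarrow> 'y2 \<Rightarrow> 'y3::finite pmf"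
    and P :: "'x1 pmf" and Q :: "'x1 \<Rightarrow> 'y2 \<Rightarrow> 'u::finite pmf" and f :: "'u \<Rightarrow> 'x1 \<Rightarrow> 'y2 \<Rightarrow> 'x2"
  defines "J \<equiv> relay_joint W2 W3 P Q f"
  defines "R1 \<equiv> map_pmf (\<lambda>(x1, u, y2, x2, y3). (x1, y2)) J"
    and "R3 \<equiv> map_pmf (\<lambda>(x1, u, y2, x2, y3). ((x1, u), y3)) J"
  assumes c: "0 < c1" "0 < c2" "0 < c3" and \<delta>: "0 < \<delta>" and M: "1 \<le> M"
    and e1: "measure_pmf.prob (block_pmf n (\<lambda>_. R1)) {g. (\<Sum>i<n. info_density R1 (g i)) \<le> log 2 c1} \<le> e1"
    and e2: "measure_pmf.prob (block_pmf n (\<lambda>_. relay_xuy P W2 Q))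
        {g. log 2 c2 \<le> (\<Sum>i<n. cond_info_density W2 Q (g i))} \<le> e2"
    and e3: "measure_pmf.prob (block_pmf n (\<lambda>_. R3)) {g. (\<Sum>i<n. info_density R3 (g i)) \<le> log 2 c3} \<le> e3"
  shows "\<exists>enc rel dec. error_prob W2 W3 n M enc rel dec \<le>
    e1 + (e2 + e3 / \<delta>) + exp (- (1 / c2) * real L) + \<delta> + real M * (1 / c1 + real L * (1 / c3))"
proof -
  define PU where "PU x = bind_pmf (W2 x) (Q x)" for x
  define Vn where "Vn xs ys = block_pmf n (\<lambda>i. Q (xs i) (ys i))" for xs ys
  define W3n where "W3n xs as ys = block_pmf n (\<lambda>i. W3 (xs i) (as i) (ys i))" for xs as ys
  define F where "F us xs ys i = f (us i) (xs i) (ys i)" for us xs ys and i :: nat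
  define T1 where "T1 xs ys \<longleftrightarrow> likely n R1 c1 (\<lambda>i. (xs i, ys i))" for xs ys
  \<comment> \<open>Unlike the two decoding tests, this bounds the likelihood ratio from above;
    summed over the accepted words it gives the covering constant 1 / c2.\<close>
  define T2 where "T2 xs us ys \<longleftrightarrow> (\<Prod>i<n. pmf (Q (xs i) (ys i)) (us i)) \<le>
      c2 * (\<Prod>i<n. pmf (PU (xs i)) (us i))"
    for xs us ys
  define T3 where "T3 xs us zs \<longleftrightarrow> likely n R3 c3 (\<lambda>i. ((xs i, us i), zs i))" for xs us zs
  \<comment> \<open>Including the receiver's conditional failure probability makes
    \<open>T3_typical\<close> immediate. The price, by Markov's inequality, is the term
    \<open>e3 / \<delta>\<close>.\<close>
  define G where "G xs us ys \<longleftrightarrow> T2 xs us ys \<and> measure_pmf.prob (W3n xs (F us xs ys) ys)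
      {zs. \<not> T3 xs us zs} \<le> \<delta>"
    for xs us ys
  define N where "N = bind_pmf (block_pmf n (\<lambda>_. P)) (\<lambda>xs. bind_pmf (block_pmf n (\<lambda>i. W2 (xs i))) (\<lambda>ys.
     map_pmf (\<lambda>us. (xs, us, ys)) (Vn xs ys)))"
  have R1: "R1 = bind_pmf P (\<lambda>x. map_pmf (Pair x) (W2 x))"
    unfolding R1_def J_def by (rule relay_joint_x1_y2)
  have fst_R1: "map_pmf fst R1 = P"
    unfolding R1 by (simp add: map_bind_pmf map_pmf_comp bind_return_pmf')
  have R3: "R3 = bind_pmf P (\<lambda>x. bind_pmf (W2 x) (\<lambda>y. bind_pmf (Q x y)
      (\<lambda>u. map_pmf (\<lambda>z. ((x, u), z)) (W3 x (f u x y) y))))"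
    unfolding R3_def J_def by (rule relay_joint_x1u_y3)
  have fst_R3: "map_pmf fst R3 = bind_pmf P (\<lambda>x. map_pmf (Pair x) (PU x))"
    unfolding R3_def J_def PU_def by (rule relay_joint_x1_u)
  have likely_if: "likely n R c (\<lambda>i. if i < n then g i else undefined) =
      likely n R c g" for R :: "('c \<times> 'd) pmf" and c g
    by (rule likely_cong) simp
  have likely_if': "likely n R c (\<lambda>i. (if i < n then g i else undefined, h i)) =
      likely n R c (\<lambda>i. (g i, h i))"
    for R :: "('c \<times> 'd) pmf" and c g h
    by (rule likely_cong) simp

  have T2_typical: "measure_pmf.prob N {(xs, us, ys). \<not> T2 xs us ys} \<le> e2"
  proof -
    let ?D = "{g. log 2 c2 \<le> (\<Sum>i<n. cond_info_density W2 Q (g i))}"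
    \<comment> \<open>Turns a triple of blocks into a block of triples.\<close>
    let ?emb = "\<lambda>(xs, us, ys) i. if i < n then (xs i, us i, ys i) else undefined"
    have "measure_pmf.prob N {(xs, us, ys). \<not> T2 xs us ys} \<le> measure_pmf.prob N (?emb -` ?D)"
    proof (rule measure_pmf.finite_measure_mono_AE)
      have "?emb (xs, us, ys) \<in> ?D" if mem: "(xs, us, ys) \<in> set_pmf N"
          and nT: "\<not> T2 xs us ys" for xs us ys
      proof -
        have "(xs i, us i, ys i) \<in> set_pmf (relay_xuy P W2 Q)" if "i < n" for i
          using mem that unfolding N_def Vn_def relay_xuy_def
          by (fastforce simp: set_Pi_pmf PiE_dflt_def)
        note pos = relay_xuy_pos(3,4)[OF this]
        let ?p = "\<Prod>i<n. pmf (Q (xs i) (ys i)) (us i)"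
        let ?q = "\<Prod>i<n. pmf (PU (xs i)) (us i)"
        have q: "0 < ?q" unfolding PU_def using pos by (intro prod_pos) auto
        have "log 2 c2 \<le> log 2 (?p / ?q)"
          using nT q c by (intro log_mono) (auto simp: T2_def le_divide_eq)
        also have "?p / ?q = (\<Prod>i<n. pmf (Q (xs i) (ys i)) (us i) / pmf (PU (xs i)) (us i))"
          by (simp only: prod_dividef)
        also have "log 2 \<dots> = (\<Sum>i<n. cond_info_density W2 Q (xs i, us i, ys i))"
          unfolding cond_info_density_def log_def PU_def using pos
          by (subst ln_prod) (force simp: sum_divide_distrib)+
        finally show ?thesis by simp
      qed
      then show "AE t in measure_pmf N. t \<in> {(xs, us, ys). \<not> T2 xs us ys} \<longrightarrow> t \<in> ?emb -` ?D"
        by (auto simp: AE_measure_pmf_iff)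
    qed auto
    also have "\<dots> = measure_pmf.prob (map_pmf ?emb N) ?D" by simp
    also have "map_pmf ?emb N = block_pmf n (\<lambda>_. relay_xuy P W2 Q)"
      unfolding relay_xuy_def block_pmf_triple N_def Vn_def by (simp add: map_bind_pmf map_pmf_comp)
    finally show ?thesis using e2 by simp
  qed

  let ?\<phi> = "\<lambda>(xs, us, ys). measure_pmf.prob (W3n xs (F us xs ys) ys) {zs. \<not> T3 xs us zs}"
  have T3_exp: "measure_pmf.expectation N ?\<phi> \<le> e3"
  proof -
    let ?emb = "\<lambda>((xs, us, ys), zs) i. if i < n then ((xs i, us i), zs i) else undefined"
    let ?N' = "bind_pmf N (\<lambda>(xs, us, ys). map_pmf (Pair (xs, us, ys)) (W3n xs (F us xs ys) ys))"
    have "measure_pmf.expectation N ?\<phi> = measure_pmf.prob ?N' {((xs, us, ys), zs). \<not> T3 xs us zs}"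
      by (simp add: prob_bind_pmf case_prod_unfold vimage_def)
    also have "{((xs, us, ys), zs). \<not> T3 xs us zs} = ?emb -` {g. \<not> likely n R3 c3 g}"
      by (auto simp: T3_def likely_if)
    also have "measure_pmf.prob ?N' (?emb -` {g. \<not> likely n R3 c3 g}) =
        measure_pmf.prob (map_pmf ?emb ?N') {g. \<not> likely n R3 c3 g}" by simp
    also have "map_pmf ?emb ?N' = block_pmf n (\<lambda>_. R3)"
      unfolding R3 block_pmf_quadruple N_def Vn_def W3n_def F_def
      by (simp add: map_bind_pmf bind_assoc_pmf bind_map_pmf map_pmf_comp)
    also have "measure_pmf.prob (block_pmf n (\<lambda>_. R3)) {g. \<not> likely n R3 c3 g} \<le> e3"
      using prob_not_likely_le[of c3 n R3] c e3 by simp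
    finally show ?thesis .
  qed

  interpret relay_random_coding "block_pmf n (\<lambda>_. P)" "\<lambda>xs. block_pmf n (\<lambda>i. W2 (xs i))" Vn
    "\<lambda>xs. block_pmf n (\<lambda>i. PU (xs i))" W3n F T1 G T3 e1 "e2 + e3 / \<delta>" "1 / c2" \<delta> "1 / c1" "1 / c3"
  proof
    have "measure_pmf.expectation (block_pmf n (\<lambda>_. P))
        (\<lambda>xs. measure_pmf.prob (block_pmf n (\<lambda>i. W2 (xs i))) {ys. \<not> T1 xs ys}) =
        measure_pmf.prob (block_pmf n (\<lambda>_. R1)) {g. \<not> likely n R1 c1 g}"
      unfolding block_pmf_pair R1[symmetric] T1_def
      by (subst (2) R1) (simp add: block_pmf_pair prob_bind_pmf vimage_def likely_if)
    also have "\<dots> \<le> e1"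
      using prob_not_likely_le[of c1 n R1] c e1 by simp
    finally show "measure_pmf.expectation (block_pmf n (\<lambda>_. P))
       (\<lambda>xs. measure_pmf.prob (block_pmf n (\<lambda>i. W2 (xs i))) {ys. \<not> T1 xs ys}) \<le> e1" .
    show "measure_pmf.prob (block_pmf n (\<lambda>_. P)) {xs. T1 xs ys} \<le> 1 / c1" for ys
      using prob_likely_packing[of c1 n R1 ys] c by (simp only: T1_def fst_R1)
    have "measure_pmf.expectation (block_pmf n (\<lambda>_. P))
        (\<lambda>xs. measure_pmf.expectation (block_pmf n (\<lambda>i. W2 (xs i)))
        (\<lambda>ys. measure_pmf.prob (Vn xs ys) {us. \<not> G xs us ys})) =
            measure_pmf.prob N {(xs, us, ys). \<not> G xs us ys}"
      unfolding N_def by (simp add: prob_bind_pmf vimage_def)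
    also have "{(xs, us, ys). \<not> G xs us ys} = {(xs, us, ys). \<not> T2 xs us ys} \<union> {t. \<delta> < ?\<phi> t}"
      by (auto simp: G_def)
    also have "measure_pmf.prob N ({(xs, us, ys). \<not> T2 xs us ys} \<union> {t. \<delta> < ?\<phi> t}) \<le>
        measure_pmf.prob N {(xs, us, ys). \<not> T2 xs us ys} + measure_pmf.prob N {t. \<delta> < ?\<phi> t}"
      by (rule measure_Un_le) auto
    also have "measure_pmf.prob N {t. \<delta> < ?\<phi> t} \<le> measure_pmf.expectation N ?\<phi> / \<delta>"
      using \<delta> by (intro prob_Collect_gt_le) (auto simp: case_prod_unfold)
    also have "\<dots> \<le> e3 / \<delta>"
      using T3_exp \<delta> by (intro divide_right_mono) auto
    finally show "measure_pmf.expectation (block_pmf n (\<lambda>_. P))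
        (\<lambda>xs. measure_pmf.expectation (block_pmf n (\<lambda>i. W2 (xs i)))
        (\<lambda>ys. measure_pmf.prob (Vn xs ys) {us. \<not> G xs us ys})) \<le> e2 + e3 / \<delta>"
      using T2_typical by simp
    show "1 / c2 * measure_pmf.prob (Vn xs ys) {us. G xs us ys} \<le>
        measure_pmf.prob (block_pmf n (\<lambda>i. PU (xs i))) {us. G xs us ys}" for xs ys
    proof -
      have "measure_pmf.prob (Vn xs ys) {us. G xs us ys} \<le>
          c2 * measure_pmf.prob (block_pmf n (\<lambda>i. PU (xs i))) {us. G xs us ys}"
        by (rule prob_le_of_pmf_le) (auto simp: Vn_def pmf_Pi G_def T2_def)
      then show ?thesis using c by (simp add: field_simps)
    qed
    show "G xs us ys \<Longrightarrow> measure_pmf.prob (W3n xs (F us xs ys) ys) {zs. \<not> T3 xs us zs} \<le> \<delta>" for xs us ys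
      by (simp add: G_def)
    have "measure_pmf.expectation (block_pmf n (\<lambda>_. P))
        (\<lambda>xs. measure_pmf.prob (block_pmf n (\<lambda>i. PU (xs i))) {us. T3 xs us zs}) =
        measure_pmf.prob (block_pmf n (\<lambda>_. map_pmf fst R3)) {g. likely n R3 c3 (\<lambda>i. (g i, zs i))}" for zs
      unfolding fst_R3 block_pmf_pair T3_def by (simp add: prob_bind_pmf vimage_def likely_if')
    then show "measure_pmf.expectation (block_pmf n (\<lambda>_. P))
        (\<lambda>xs. measure_pmf.prob (block_pmf n (\<lambda>i. PU (xs i))) {us. T3 xs us zs}) \<le> 1 / c3" for zs
      using prob_likely_packing[of c3 n R3 zs] c by simp
  qed (use c \<delta> in auto)
  let ?B = "e1 + (e2 + e3 / \<delta>) + exp (- (1 / c2) * real L) + \<delta> + real M * (1 / c1 + real L * (1 / c3))"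
  obtain enc rel dec where code: "(\<Sum>m\<in>{1..M}. measure_pmf.prob
      (bind_pmf (block_pmf n (\<lambda>i. W2 (enc m i))) (\<lambda>ys. W3n (enc m)
          (rel ys) ys)) {zs. dec zs \<noteq> Some m}) \<le> real M * ?B"
    using exists_relay_code[of M L] by blast
  have "error_prob W2 W3 n M enc (\<lambda>i ys. rel (list_to_fun n ys) i) (\<lambda>zs. dec (list_to_fun n zs)) \<le>
      1 / real M * (real M * ?B)"
    unfolding error_prob_list_to_fun using code by (intro mult_left_mono) (simp_all add: W3n_def)
  also have "\<dots> = ?B" using M by simp
  finally show ?thesis by blast
qed

section \<open>Choice of exponents and the limit\<close>

lemma error_prob_nonneg: "0 \<le> error_prob W2 W3 n M enc rel dec"
  unfolding error_prob_def by (intro mult_nonneg_nonneg sum_nonneg prod_nonneg) auto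

text \<open>At rate 0 there is a single message, which a constant decoder always guesses.\<close>

lemma achievable_zero: "achievable W2 W3 0"
proof -
  have "num_msgs n 0 = 1" for n by (simp add: num_msgs_def)
  then have "error_prob W2 W3 n (num_msgs n 0) enc rel (\<lambda>_. Some 1) = 0" for n enc rel
    by (simp add: error_prob_def)
  then show ?thesis unfolding achievable_def
    by (intro conjI exI[of _ "\<lambda>_. undefined"] exI[of _ "\<lambda>_ _. Some 1"]) auto
qed

lemma nat_ceiling_powr_bounds:
  assumes "0 \<le> r"
  shows "2 powr r \<le> real (nat \<lceil>2 powr r\<rceil>)" "real (nat \<lceil>2 powr r\<rceil>) \<le> 2 * 2 powr r"
proof -
  have 1: "1 \<le> 2 powr r" using assms by (simp add: ge_one_powr_ge_zero)
  then show "2 powr r \<le> real (nat \<lceil>2 powr r\<rceil>)" by linarith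
  show "real (nat \<lceil>2 powr r\<rceil>) \<le> 2 * 2 powr r" using 1 by linarith
qed

lemma achievable_below:
  fixes W2 :: "'x1::finite \<Rightarrow> 'y2::finite pmf" and W3 :: "'x1 \<Rightarrow> 'x2::finite \<Rightarrow> 'y2 \<Rightarrow> 'y3::finite pmf"
    and P :: "'x1 pmf" and Q :: "'x1 \<Rightarrow> 'y2 \<Rightarrow> 'u::finite pmf" and f :: "'u \<Rightarrow> 'x1 \<Rightarrow> 'y2 \<Rightarrow> 'x2"
  defines "J \<equiv> relay_joint W2 W3 P Q f"
  defines "R1 \<equiv> map_pmf (\<lambda>(x1, u, y2, x2, y3). (x1, y2)) J"
    and "R3 \<equiv> map_pmf (\<lambda>(x1, u, y2, x2, y3). ((x1, u), y3)) J"
  assumes R: "0 \<le> R" "R < mutual_info R1"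
    "R < mutual_info R3 - cond_mutual_info (map_pmf (\<lambda>(x1, u, y2, x2, y3). (u, y2, x1)) J)"
  shows "achievable W2 W3 R"
proof -
  define N where "N = relay_xuy P W2 Q"
  define h where "h = cond_info_density W2 Q"
  define I1 where "I1 = mutual_info R1"
  define I2 where "I2 = measure_pmf.expectation N h"
  define I3 where "I3 = mutual_info R3"
  have I2_eq: "cond_mutual_info (map_pmf (\<lambda>(x1, u, y2, x2, y3). (u, y2, x1)) J) = I2"
    unfolding J_def I2_def N_def h_def by (rule cond_mutual_info_eq_expectation)
  have I2_nonneg: "0 \<le> I2"
    unfolding I2_def N_def h_def by (rule expectation_cond_info_density_nonneg)
  \<comment> \<open>A quarter of the slack. Each threshold gives up \<epsilon> and \<open>L\<close>
    adds another \<epsilon> over the covering threshold, so the tightest packing exponent, R + (I2 +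
    2 \<epsilon>) - (I3 - \<epsilon>), is still at most - \<epsilon>.\<close>
  define \<epsilon> where "\<epsilon> = min (I1 - R) (I3 - I2 - R) / 4"
  have \<epsilon>: "0 < \<epsilon>" "R + 4 * \<epsilon> \<le> I1" "R + I2 + 4 * \<epsilon> \<le> I3"
    using R unfolding I2_eq \<epsilon>_def I1_def[symmetric] I3_def[symmetric] by auto
  obtain \<kappa>1 where \<kappa>1: "0 < \<kappa>1" "\<And>n. measure_pmf.prob (block_pmf n (\<lambda>_. R1))
      {g. (\<Sum>i<n. info_density R1 (g i)) \<le> real n * (I1 - \<epsilon>)} \<le> exp (- \<kappa>1 * real n)"
    using prob_Pi_pmf_sum_le[OF \<epsilon>(1), of R1 "info_density R1"]
    unfolding I1_def mutual_info_eq_expectation by blast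
  \<comment> \<open>The upper tail is needed here, so the lower-tail bound is applied to the negated
    density.\<close>
  obtain \<kappa>2 where \<kappa>2: "0 < \<kappa>2" "\<And>n. measure_pmf.prob (block_pmf n (\<lambda>_. N))
      {g. (\<Sum>i<n. - h (g i)) \<le> real n * (- I2 - \<epsilon>)} \<le> exp (- \<kappa>2 * real n)"
    using prob_Pi_pmf_sum_le[OF \<epsilon>(1), of N "\<lambda>r. - h r"]
    unfolding I2_def by (auto simp: Bochner_Integration.integral_minus)
  obtain \<kappa>3 where \<kappa>3: "0 < \<kappa>3" "\<And>n. measure_pmf.prob (block_pmf n (\<lambda>_. R3))
      {g. (\<Sum>i<n. info_density R3 (g i)) \<le> real n * (I3 - \<epsilon>)} \<le> exp (- \<kappa>3 * real n)"
    using prob_Pi_pmf_sum_le[OF \<epsilon>(1), of R3 "info_density R3"]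
    unfolding I3_def mutual_info_eq_expectation by blast
  define B where "B n = exp (- \<kappa>1 * real n) + exp (- \<kappa>2 * real n) + 2 * exp (- (\<kappa>3 / 2) * real n) +
      exp (- (2 powr (\<epsilon> * real n))) + 6 * 2 powr (- \<epsilon> * real n)" for n :: nat
  have "\<exists>enc rel dec. error_prob W2 W3 n (num_msgs n R) enc rel dec \<le> B n" for n
  proof -
    define M where "M = num_msgs n R"
    \<comment> \<open>\<open>L\<close> exceeds \<open>c2\<close> by a factor of at least 2 powr
      (\<epsilon> n), which makes the covering failure doubly exponentially small.\<close>
    define L where "L = nat \<lceil>2 powr (real n * (I2 + 2 * \<epsilon>))\<rceil>"
    define c1 where "c1 = 2 powr (real n * (I1 - \<epsilon>))"
    define c2 where "c2 = 2 powr (real n * (I2 + \<epsilon>))"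
    define c3 where "c3 = 2 powr (real n * (I3 - \<epsilon>))"
    \<comment> \<open>The square root of the third tail bound, which balances \<delta> against that
      bound divided by \<delta>.\<close>
    define \<delta> where "\<delta> = exp (- (\<kappa>3 / 2) * real n)"
    have M: "2 powr (real n * R) \<le> real M" "real M \<le> 2 * 2 powr (real n * R)"
      unfolding M_def num_msgs_def using R by (intro nat_ceiling_powr_bounds; simp)+
    have L: "2 powr (real n * (I2 + 2 * \<epsilon>)) \<le> real L" "real L \<le> 2 * 2 powr (real n * (I2 + 2 * \<epsilon>))"
      unfolding L_def using I2_nonneg \<epsilon> by (intro nat_ceiling_powr_bounds; simp)+
    have "0 < real M" by (rule less_le_trans[OF _ M(1)]) simp
    then have M1: "1 \<le> M" by simp
    have "\<exists>enc rel dec. error_prob W2 W3 n M enc rel dec \<le>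
      exp (- \<kappa>1 * real n) + (exp (- \<kappa>2 * real n) + exp (- \<kappa>3 * real n) / \<delta>) +
          exp (- (1 / c2) * real L) + \<delta> +
      real M * (1 / c1 + real L * (1 / c3))"
    proof (rule exists_block_code[where ?W2.0 = W2 and ?W3.0 = W3 and P = P and Q = Q and f =
        f, folded J_def, folded R1_def R3_def N_def h_def])
      show "measure_pmf.prob (block_pmf n (\<lambda>_. R1)) {g. (\<Sum>i<n. info_density R1 (g i)) \<le> log 2 c1} \<le>
          exp (- \<kappa>1 * real n)"
        using \<kappa>1(2) by (simp add: c1_def)
      show "measure_pmf.prob (block_pmf n (\<lambda>_. R3)) {g. (\<Sum>i<n. info_density R3 (g i)) \<le> log 2 c3} \<le>
          exp (- \<kappa>3 * real n)"
        using \<kappa>3(2) by (simp add: c3_def)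
      have "{g. log 2 c2 \<le> (\<Sum>i<n. h (g i))} = {g. (\<Sum>i<n. - h (g i)) \<le> real n * (- I2 - \<epsilon>)}"
        by (auto simp: c2_def sum_negf algebra_simps)
      then show "measure_pmf.prob (block_pmf n (\<lambda>_. N)) {g. log 2 c2 \<le> (\<Sum>i<n. h (g i))} \<le>
          exp (- \<kappa>2 * real n)"
        using \<kappa>2(2) by simp
    qed (use M1 in \<open>auto simp: c1_def c2_def c3_def \<delta>_def\<close>)
    moreover have "exp (- \<kappa>3 * real n) / \<delta> = \<delta>"
      unfolding \<delta>_def by (simp add: exp_diff[symmetric])
    moreover have "exp (- (1 / c2) * real L) \<le> exp (- (2 powr (\<epsilon> * real n)))"
    proof -
      have "2 powr (\<epsilon> * real n) = 2 powr (real n * (I2 + 2 * \<epsilon>)) / c2"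
        unfolding c2_def by (simp add: powr_diff[symmetric] algebra_simps)
      also have "\<dots> \<le> real L / c2" using L(1) by (intro divide_right_mono) (auto simp: c2_def)
      finally show ?thesis by simp
    qed
    \<comment> \<open>Rounding up costs a factor 2 for \<open>M\<close> and 2 for \<open>L\<close>;
      the constant 6 is 2 for the relay plus 4 for the receiver.\<close>
    moreover have "real M * (1 / c1 + real L * (1 / c3)) \<le> 6 * 2 powr (- \<epsilon> * real n)"
    proof -
      have "real M * (1 / c1) \<le> (2 * 2 powr (real n * R)) * (1 / c1)"
        using M(2) by (intro mult_right_mono) (auto simp: c1_def)
      also have "\<dots> = 2 * 2 powr (real n * (R - I1 + \<epsilon>))"
        unfolding c1_def by (simp add: right_diff_distrib distrib_left powr_diff powr_add)
      also have "\<dots> \<le> 2 * 2 powr (real n * - \<epsilon>)"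
        using \<epsilon> by (intro mult_left_mono powr_mono) auto
      finally have 1: "real M * (1 / c1) \<le> 2 * 2 powr (- \<epsilon> * real n)" by (simp add: mult.commute)
      have "real M * (real L * (1 / c3)) \<le>
          (2 * 2 powr (real n * R)) * ((2 * 2 powr (real n * (I2 + 2 * \<epsilon>))) * (1 / c3))"
        using M(2) L(2) by (intro mult_mono mult_right_mono mult_nonneg_nonneg) (auto simp: c3_def)
      also have "\<dots> = 4 * 2 powr (real n * (R + (I2 + 2 * \<epsilon>) - (I3 - \<epsilon>)))"
        unfolding c3_def by (simp only: right_diff_distrib[of "real n" "_ + _"] distrib_left[of "real n" R] powr_diff powr_add)
          simp
      also have "\<dots> \<le> 4 * 2 powr (real n * - \<epsilon>)"
        using \<epsilon> by (intro mult_left_mono powr_mono) auto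
      finally have "real M * (real L * (1 / c3)) \<le> 4 * 2 powr (- \<epsilon> * real n)" by (simp add: mult.commute)
      with 1 show ?thesis by (simp add: distrib_left)
    qed
    moreover have "B n = exp (- \<kappa>1 * real n) + exp (- \<kappa>2 * real n) + 2 * \<delta> +
        exp (- (2 powr (\<epsilon> * real n))) + 6 * 2 powr (- \<epsilon> * real n)"
      by (simp only: B_def \<delta>_def)
    ultimately have "\<exists>enc rel dec. error_prob W2 W3 n M enc rel dec \<le> B n"
      by (smt (verit, del_insts))
    then show ?thesis by (simp only: M_def)
  qed
  then obtain enc rel dec where err: "\<And>n. error_prob W2 W3 n (num_msgs n R) (enc n) (rel n)
      (dec n) \<le> B n"
    by metis
  have exp0: "(\<lambda>n. exp (- \<kappa> * real n)) \<longlonglongrightarrow> 0" if "0 < \<kappa>" for \<kappa> :: real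
    using that by real_asymp
  have "(\<lambda>n. exp (- (2 powr (\<epsilon> * real n)))) \<longlonglongrightarrow> 0" "(\<lambda>n. 2 powr (- \<epsilon> * real n)) \<longlonglongrightarrow> 0"
    using \<epsilon>(1) by real_asymp+
  then have "B \<longlonglongrightarrow> 0 + 0 + 2 * 0 + 0 + 6 * 0"
    unfolding B_def using \<kappa>1(1) \<kappa>2(1) \<kappa>3(1) by (intro tendsto_intros exp0) auto
  then have "B \<longlonglongrightarrow> 0" by simp
  then have "(\<lambda>n. error_prob W2 W3 n (num_msgs n R) (enc n) (rel n) (dec n)) \<longlonglongrightarrow> 0"
    by (intro tendsto_sandwich[OF _ _ tendsto_const \<open>B \<longlonglongrightarrow> 0\<close>]) (auto simp: error_prob_nonneg err)
  then show ?thesis unfolding achievable_def using R(1) by blast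
qed

theorem theorem1:
  fixes W2 :: "'x1::finite \<Rightarrow> 'y2::finite pmf"
    and W3 :: "'x1 \<Rightarrow> 'x2::finite \<Rightarrow> 'y2 \<Rightarrow> 'y3::finite pmf"
    and P :: "'x1 pmf"
    and Q :: "'x1 \<Rightarrow> 'y2 \<Rightarrow> 'u::finite pmf"
    and f :: "'u \<Rightarrow> 'x1 \<Rightarrow> 'y2 \<Rightarrow> 'x2"
  defines "J \<equiv> relay_joint W2 W3 P Q f"
  shows "capacity_noncausal W2 W3 \<ge>
    ereal (min (mutual_info (map_pmf (\<lambda>(x1, u, y2, x2, y3). (x1, y2)) J))
               (mutual_info (map_pmf (\<lambda>(x1, u, y2, x2, y3). ((x1, u), y3)) J)
                - cond_mutual_info (map_pmf (\<lambda>(x1, u, y2, x2, y3). (u, y2, x1)) J)))"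
    (is "_ \<ge> ereal ?m")
proof (rule ccontr)
  have le: "ereal R \<le> capacity_noncausal W2 W3" if "achievable W2 W3 R" for R
    unfolding capacity_noncausal_def using that by (auto intro: Sup_upper)
  assume "\<not> capacity_noncausal W2 W3 \<ge> ereal ?m"
  then have "capacity_noncausal W2 W3 < ereal ?m" by (simp only: not_le)
  then obtain R where R: "capacity_noncausal W2 W3 < ereal R" "ereal R < ereal ?m"
    using ereal_dense2 by blast
  \<comment> \<open>Rate 0 is achievable, so a rate above the capacity is positive. This supplies
    the sign condition of \<open>achievable_below\<close> and covers a negative bound as
    well.\<close>
  have "ereal 0 < ereal R"
    using le[OF achievable_zero] R(1) by (rule order.strict_trans1)
  then have "achievable W2 W3 R"
    using R(2) unfolding J_def by (intro achievable_below[where P = P and Q = Q and f = f]) auto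
  then show False using le[of R] R(1) by simp
qed

end
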